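(* Let $d,n\ge1$ be integers. Consider an $n$-copy estimation problem with single-copy prior $p$, parameters $\vec{\mathfrak{s}}=(\mathfrak{s}^{(1)},\dots,\mathfrak{s}^{(l)})$ and channel $\mathcal{E}$ (described in the context), and assume the figure of merit for a strategy (POVM) $M$ can be expressed as a functional of the conditional probabilities $q_M(B|\vec S\in\vec\Delta)$ ($B\in\sigma(\Omega)$, $\vec\Delta\subseteq\mathbb{R}^l$ an $l$-dimensional interval of nonzero probability). Suppose that for a von Neumann algebra $\mathcal{A}\subseteq\mathrm{End}(\mathbb{C}^d)$ with gauge group $G_{\mathcal{A}}$: 1. $p$ and $\vec{\mathfrak{s}}$ have $G_{\mathcal{A}}$ as a symmetry; 2. $\mathcal{E}$ is noiseless on $\mathcal{A}^{\otimes n}$ (for instance, $\mathcal{E}$ is the identity channel); 3. $p$ is a $G_{\mathcal{A}}$-distortion of a prior that has support only on the pure states (for instance, $p$ itself has support only on the pure states). Then the POVM elements of the optimal measurement can be chosen to be in $\mathcal{A}^{\otimes n}$; that is, for every optimal POVM $M:\sigma(\Omega)\to\mathrm{End}((\mathbb{C}^d)^{\otimes n})$ for the figure of merit there is an optimal POVM $M':\sigma(\Omega)\to\mathcal{A}^{\otimes n}$.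
   Context: A von Neumann algebra $\mathcal{A}\subseteq\mathrm{End}(\mathbb{C}^d)$ is a complex subalgebra containing the identity and closed under adjoint; its gauge group $G_{\mathcal{A}}$ is the group of all unitaries in $\mathrm{U}(d)$ commuting with every element of $\mathcal{A}$. A quantum channel is a completely positive trace-preserving map. Scenario: $d\rho$ is a fixed reference (Borel) measure on the set of density operators in $\mathrm{End}(\mathbb{C}^d)$, invariant under $\rho\mapsto V\rho V^\dagger$ for all $V\in\mathrm{U}(d)$. A state $\rho$ is chosen randomly according to a probability density $p$ relative to $d\rho$ (the single-copy prior), and $\rho^{\otimes n}$ is sent through a quantum channel $\mathcal{E}$ on $\mathrm{End}((\mathbb{C}^d)^{\otimes n})$, then measured. $\mathrm{supp}(p)$ is the set of states to which $p$ assigns nonzero density. The parameters are (measurable) functions $\mathfrak{s}^{(i)}:\mathrm{supp}(p)\to\mathbb{R}$, $\vec{\mathfrak{s}}=(\mathfrak{s}^{(1)},\dots,\mathfrak{s}^{(l)})$, and $\vec S=\vec{\mathfrak{s}}(\rho)$ is the induced random vector. $p$ has a subgroup $H\subseteq\mathrm{U}(d)$ as a symmetry if $p(V\rho V^\dagger)=p(\rho)$ for all $V\in H$ and all $\rho$. $\vec{\mathfrak{s}}$ has $H$ as a symmetry if $\vec{\mathfrak{s}}(V\rho V^\dagger)=\vec{\mathfrak{s}}(\rho)$ for all $V\in H$ and all $\rho\in\mathrm{supp}(p)$. $\mathcal{E}$ is noiseless on $\mathcal{A}^{\otimes n}$ if $\mathrm{tr}(R\,\mathcal{E}(\rho))=\mathrm{tr}(R\rho)$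 for all $R\in\mathcal{A}^{\otimes n}$ and all states $\rho$ in $\mathrm{End}((\mathbb{C}^d)^{\otimes n})$ (and analogously for a channel on $\mathrm{End}(\mathbb{C}^d)$ and $\mathcal{A}$). Given a prior density $\tilde p$ (relative to $d\rho$) with support confined to pure states, $p$ is a $G_{\mathcal{A}}$-distortion of $\tilde p$ via $\mathcal{N}$ if $p$ can be realized by sampling a pure state from $\tilde p$ and applying a quantum channel $\mathcal{N}$ on $\mathrm{End}(\mathbb{C}^d)$ to it (i.e. the law with density $p$ is the pushforward under $\mathcal{N}$ of the law with density $\tilde p$), where $\mathcal{N}$ is noiseless on $\mathcal{A}$ and $G_{\mathcal{A}}$-covariant, i.e. $\mathcal{N}(V\cdot V^\dagger)=V\mathcal{N}(\cdot)V^\dagger$ for all $V\in G_{\mathcal{A}}$. A POVM with outcome space a measurable space $(\Omega,\sigma(\Omega))$ is a countably additive map $M$ from $\sigma(\Omega)$ to positive operators with $M(\Omega)=\mathbb{I}^{\otimes n}$. Set $q_M(B|\rho)=\mathrm{tr}(M(B)\mathcal{E}(\rho^{\otimes n}))$, $\Pr(\vec S\in\vec\Delta)=\int_{\vec{\mathfrak{s}}(\rho)\in\vec\Delta}d\rho\,p(\rho)$ and $$q_M(B|\vec S\in\vec\Delta)=\frac{1}{\Pr(\vec S\in\vec\Delta)}\int_{\vec{\mathfrak{s}}(\rho)\in\vec\Delta}d\rho\,p(\rho)\,q_M(B|\rho).$$ A figure of merit assigns a real number to each POVM on the fixed outcome space $\Omega$; it is a functional of $q_M(B|\vec S\in\vec\Delta)$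 if it takes equal values on any two POVMs for which these conditional probabilities all agree. A POVM is optimal if it maximizes (or minimizes, for a cost) the figure of merit over all POVMs $\sigma(\Omega)\to\mathrm{End}((\mathbb{C}^d)^{\otimes n})$. *)

theory Defs
  imports "HOL-Probability.Probability"
begin

text \<open>
  Operators on the Hilbert space with orthonormal basis indexed by a finite type \<open>'m\<close> are
  complex matrices indexed by \<open>'m\<close>. For \<open>d = CARD('d)\<close> and \<open>n = CARD('n)\<close>, the \<open>n\<close>-fold tensor
  power of the \<open>d\<close>-dimensional space has the product basis, which is indexed by the finite
  type \<open>'n \<Rightarrow> 'd\<close>.
\<close>

type_synonym 'm operator = "complex^'m^'m"

subsection \<open>Complex matrices\<close>

definition scale_mat :: "complex \<Rightarrow> 'm::finite operator \<Rightarrow> 'm operator" (infixr \<open>*\<^sub>M\<close> 75) where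
  "c *\<^sub>M A = map_matrix (\<lambda>x. c * x) A"

global_interpretation mat_space: vector_space "(*\<^sub>M) :: complex \<Rightarrow> 'm::finite operator \<Rightarrow> 'm operator"
  by unfold_locales (simp_all add: scale_mat_def map_matrix_def vec_eq_iff algebra_simps)

definition adj :: "'m::finite operator \<Rightarrow> 'm operator" where
  "adj A = map_matrix cnj (transpose A)"

definition cinner :: "complex^'m \<Rightarrow> complex^'m::finite \<Rightarrow> complex" where
  "cinner v w = (\<Sum>i\<in>UNIV. cnj (v $ i) * w $ i)"

definition positive_op :: "'m::finite operator \<Rightarrow> bool" where
  "positive_op A \<longleftrightarrow> (\<forall>v. cinner v (A *v v) \<in> \<real>\<^sub>\<ge>\<^sub>0)"

definition unitary :: "'m::finite operator \<Rightarrow> bool" where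
  "unitary U \<longleftrightarrow> U ** adj U = mat 1 \<and> adj U ** U = mat 1"

definition conj_by :: "'m::finite operator \<Rightarrow> 'm operator \<Rightarrow> 'm operator" where
  "conj_by V X = V ** X ** adj V"

definition tensor :: "('n::finite \<Rightarrow> 'd::finite operator) \<Rightarrow> ('n \<Rightarrow> 'd) operator" where
  "tensor A = (\<chi> f g. \<Prod>k\<in>UNIV. A k $ f k $ g k)"

definition tensor_power :: "'d::finite operator \<Rightarrow> ('n::finite \<Rightarrow> 'd) operator" where
  "tensor_power A = tensor (\<lambda>_. A)"

subsection \<open>Von Neumann algebras and gauge groups\<close>

definition von_neumann_algebra :: "'m::finite operator set \<Rightarrow> bool" where
  "von_neumann_algebra \<A> \<longleftrightarrow>
     mat_space.subspace \<A> \<and> mat 1 \<in> \<A> \<and>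
     (\<forall>A\<in>\<A>. \<forall>B\<in>\<A>. A ** B \<in> \<A>) \<and> (\<forall>A\<in>\<A>. adj A \<in> \<A>)"

definition gauge_group :: "'m::finite operator set \<Rightarrow> 'm operator set" where
  "gauge_group \<A> = {U. unitary U \<and> (\<forall>A\<in>\<A>. U ** A = A ** U)}"

definition algebra_tensor_power :: "'d::finite operator set \<Rightarrow> ('n::finite \<Rightarrow> 'd) operator set" where
  "algebra_tensor_power \<A> = mat_space.span {tensor A |A. \<forall>k. A k \<in> \<A>}"

subsection \<open>States and channels\<close>

definition density_ops :: "'m::finite operator set" where
  "density_ops = {\<rho>. positive_op \<rho> \<and> trace \<rho> = 1}"

definition pure_states :: "'m::finite operator set" where
  "pure_states = {(\<chi> i j. \<psi> $ i * cnj (\<psi> $ j)) |\<psi>. norm \<psi> = 1}"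

text \<open>
  \<open>X\<close> is regarded as a \<open>k \<times> k\<close> block matrix with blocks \<open>X i j\<close> for \<open>i, j < k\<close>, that is, as an
  operator on the tensor product of a \<open>k\<close>-dimensional ancilla with the given space. The ancilla
  dimension is a number and not a type because complete positivity quantifies over it.
\<close>
definition positive_block :: "nat \<Rightarrow> (nat \<Rightarrow> nat \<Rightarrow> 'm::finite operator) \<Rightarrow> bool" where
  "positive_block k X \<longleftrightarrow>
     (\<forall>v. (\<Sum>i<k. \<Sum>j<k. cinner (v i) (X i j *v v j)) \<in> \<real>\<^sub>\<ge>\<^sub>0)"

definition completely_positive :: "('m::finite operator \<Rightarrow> 'm operator) \<Rightarrow> bool" where
  "completely_positive \<Phi> \<longleftrightarrow>
     (\<forall>k X. positive_block k X \<longrightarrow> positive_block k (\<lambda>i j. \<Phi> (X i j)))"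

definition quantum_channel :: "('m::finite operator \<Rightarrow> 'm operator) \<Rightarrow> bool" where
  "quantum_channel \<Phi> \<longleftrightarrow>
     Vector_Spaces.linear (*\<^sub>M) (*\<^sub>M) \<Phi> \<and> completely_positive \<Phi> \<and> (\<forall>X. trace (\<Phi> X) = trace X)"

definition noiseless_on :: "'m::finite operator set \<Rightarrow> ('m operator \<Rightarrow> 'm operator) \<Rightarrow> bool" where
  "noiseless_on \<R> \<Phi> \<longleftrightarrow> (\<forall>R\<in>\<R>. \<forall>\<rho>\<in>density_ops. trace (R ** \<Phi> \<rho>) = trace (R ** \<rho>))"

definition covariant :: "'m::finite operator set \<Rightarrow> ('m operator \<Rightarrow> 'm operator) \<Rightarrow> bool" where
  "covariant H \<Phi> \<longleftrightarrow> (\<forall>V\<in>H. \<forall>X. \<Phi> (conj_by V X) = conj_by V (\<Phi> X))"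

subsection \<open>Priors and parameters\<close>

definition reference_measure :: "'d::finite operator measure \<Rightarrow> bool" where
  "reference_measure \<mu> \<longleftrightarrow>
     sets \<mu> = sets (restrict_space borel density_ops) \<and>
     (\<forall>V. unitary V \<longrightarrow> distr \<mu> \<mu> (conj_by V) = \<mu>)"

definition prior_law :: "'d::finite operator measure \<Rightarrow> ('d operator \<Rightarrow> real) \<Rightarrow> 'd operator measure"
  where "prior_law \<mu> p = density \<mu> (\<lambda>\<rho>. ennreal (p \<rho>))"

definition prior_density :: "'d::finite operator measure \<Rightarrow> ('d operator \<Rightarrow> real) \<Rightarrow> bool" where
  "prior_density \<mu> p \<longleftrightarrow>
     p \<in> borel_measurable \<mu> \<and> (\<forall>\<rho>\<in>density_ops. 0 \<le> p \<rho>) \<and> prob_space (prior_law \<mu> p)"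

definition prior_supp :: "('d::finite operator \<Rightarrow> real) \<Rightarrow> 'd operator set" where
  "prior_supp p = {\<rho>\<in>density_ops. p \<rho> \<noteq> 0}"

definition prior_symmetry :: "'d::finite operator set \<Rightarrow> ('d operator \<Rightarrow> real) \<Rightarrow> bool" where
  "prior_symmetry H p \<longleftrightarrow> (\<forall>V\<in>H. \<forall>\<rho>\<in>density_ops. p (conj_by V \<rho>) = p \<rho>)"

definition parameter_symmetry ::
  "'d::finite operator set \<Rightarrow> ('d operator \<Rightarrow> real) \<Rightarrow> ('d operator \<Rightarrow> real^'l) \<Rightarrow> bool" where
  "parameter_symmetry H p s \<longleftrightarrow> (\<forall>V\<in>H. \<forall>\<rho>\<in>prior_supp p. s (conj_by V \<rho>) = s \<rho>)"

definition distortion_via ::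
  "'d::finite operator measure \<Rightarrow> 'd operator set \<Rightarrow> ('d operator \<Rightarrow> real) \<Rightarrow>
   ('d operator \<Rightarrow> real) \<Rightarrow> ('d operator \<Rightarrow> 'd operator) \<Rightarrow> bool" where
  "distortion_via \<mu> \<A> p p' \<N> \<longleftrightarrow>
     quantum_channel \<N> \<and> noiseless_on \<A> \<N> \<and> covariant (gauge_group \<A>) \<N> \<and>
     prior_law \<mu> p = distr (prior_law \<mu> p') \<mu> \<N>"

definition distortion_of_pure ::
  "'d::finite operator measure \<Rightarrow> 'd operator set \<Rightarrow> ('d operator \<Rightarrow> real) \<Rightarrow> bool" where
  "distortion_of_pure \<mu> \<A> p \<longleftrightarrow>
     (\<exists>p' \<N>. prior_density \<mu> p' \<and> prior_supp p' \<subseteq> pure_states \<and> distortion_via \<mu> \<A> p p' \<N>)"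

subsection \<open>Measurements and figures of merit\<close>

text \<open>Only the measurable space underlying \<open>\<Omega>\<close> is used; its measure plays no role.\<close>
definition povm :: "'o measure \<Rightarrow> ('o set \<Rightarrow> 'm::finite operator) \<Rightarrow> bool" where
  "povm \<Omega> M \<longleftrightarrow>
     (\<forall>B\<in>sets \<Omega>. positive_op (M B)) \<and> M (space \<Omega>) = mat 1 \<and>
     (\<forall>F :: nat \<Rightarrow> 'o set. range F \<subseteq> sets \<Omega> \<and> disjoint_family F \<longrightarrow>
        (\<lambda>i. M (F i)) sums M (\<Union>i. F i))"

text \<open>The trace of a product of two positive operators is a nonnegative real number.\<close>
definition outcome_prob ::
  "(('n::finite \<Rightarrow> 'd::finite) operator \<Rightarrow> ('n \<Rightarrow> 'd) operator) \<Rightarrow>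
   ('o set \<Rightarrow> ('n \<Rightarrow> 'd) operator) \<Rightarrow> 'o set \<Rightarrow> 'd operator \<Rightarrow> real" where
  "outcome_prob \<E> M B \<rho> = Re (trace (M B ** \<E> (tensor_power \<rho>)))"

text \<open>The parameters are only meaningful on the support of the prior.\<close>
definition param_event ::
  "('d::finite operator \<Rightarrow> real) \<Rightarrow> ('d operator \<Rightarrow> real^'l) \<Rightarrow> (real^'l) set \<Rightarrow> 'd operator set" where
  "param_event p s \<Delta> = {\<rho>\<in>prior_supp p. s \<rho> \<in> \<Delta>}"

definition param_prob ::
  "'d::finite operator measure \<Rightarrow> ('d operator \<Rightarrow> real) \<Rightarrow> ('d operator \<Rightarrow> real^'l) \<Rightarrow>
   (real^'l) set \<Rightarrow> real" where
  "param_prob \<mu> p s \<Delta> = (LINT \<rho>:param_event p s \<Delta>|\<mu>. p \<rho>)"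

definition cond_prob ::
  "'d::finite operator measure \<Rightarrow> ('d operator \<Rightarrow> real) \<Rightarrow> ('d operator \<Rightarrow> real^'l) \<Rightarrow>
   (('n::finite \<Rightarrow> 'd) operator \<Rightarrow> ('n \<Rightarrow> 'd) operator) \<Rightarrow>
   ('o set \<Rightarrow> ('n \<Rightarrow> 'd) operator) \<Rightarrow> 'o set \<Rightarrow> (real^'l) set \<Rightarrow> real" where
  "cond_prob \<mu> p s \<E> M B \<Delta> =
     1 / param_prob \<mu> p s \<Delta> * (LINT \<rho>:param_event p s \<Delta>|\<mu>. p \<rho> * outcome_prob \<E> M B \<rho>)"

text \<open>
  On \<open>real^'l\<close>, the sets satisfying \<open>is_interval\<close> are exactly the products of \<open>CARD('l)\<close> intervals,
  each of which may be open, closed, half-open or unbounded.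
\<close>
definition functional_of_cond_probs ::
  "'o measure \<Rightarrow> 'd::finite operator measure \<Rightarrow> ('d operator \<Rightarrow> real) \<Rightarrow>
   ('d operator \<Rightarrow> real^'l::finite) \<Rightarrow> (('n::finite \<Rightarrow> 'd) operator \<Rightarrow> ('n \<Rightarrow> 'd) operator) \<Rightarrow>
   (('o set \<Rightarrow> ('n \<Rightarrow> 'd) operator) \<Rightarrow> real) \<Rightarrow> bool" where
  "functional_of_cond_probs \<Omega> \<mu> p s \<E> merit \<longleftrightarrow>
     (\<forall>M M'. povm \<Omega> M \<longrightarrow> povm \<Omega> M' \<longrightarrow>
        (\<forall>B\<in>sets \<Omega>. \<forall>\<Delta>. is_interval \<Delta> \<longrightarrow> param_prob \<mu> p s \<Delta> \<noteq> 0 \<longrightarrow>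
           cond_prob \<mu> p s \<E> M B \<Delta> = cond_prob \<mu> p s \<E> M' B \<Delta>) \<longrightarrow>
        merit M = merit M')"

end

theory Submission
  imports Defs
begin

text \<open>
  All statistics of an ensemble selected by a parameter event depend on its average \<open>n\<close>-copy state
  \<open>Z\<close> only, which commutes with \<open>V\<^bsup>\<otimes>n\<^esup>\<close> for all \<open>V\<close> in the gauge group. As the prior is a distortion
  of pure states, \<open>Z\<close> is the image under the noise of an operator \<open>X\<close> on the symmetric subspace,
  and \<open>X\<close> can be chosen gauge invariant. Such an \<open>X\<close> is determined by its values on
  \<open>\<A>\<^bsup>\<otimes>n\<^esup>\<close>, and it is recovered from them by a trace preserving positive map. The adjoint of this
  map, composed with the adjoints of the noise and the channel, takes every POVM to a POVM in
  \<open>\<A>\<^bsup>\<otimes>n\<^esup>\<close> with the same statistics. No Haar measure is needed: the twirl over the gauge group is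
  replaced by a Casimir sum over an orthonormal basis of the commutant.
\<close>

section \<open>Positive operators\<close>

text \<open>Elements of the n-fold tensor power of \<A> commute with products of independent
  commutant elements, one per factor, whereas \<open>Z\<close> is known to be invariant only under
  the same V in every factor. In general these constraints differ and forcing a POVM into the
  algebra can lose information. They become equivalent on the symmetric subspace, because
  symmetrised products of commutant elements are generated by sums of one-factor operators. This is
  why purity enters, and why a noisy prior is handled through the preimage \<open>X\<close>: the
  noise may move \<open>Z\<close> off the symmetric subspace. Once an operator lies in the algebra,
  neither noise nor channel changes its expectation values, so an operator designed for
  \<open>X\<close> can be measured after both. The Casimir map of the symmetric projector \<Theta>
  is in general neither scalar nor invertible; for the full matrix algebra it is a multiple of
  \<Theta>. Hence a generalised inverse is needed, and an extra term that restores unitality outside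
  its support.\<close>

lemma adj_nth [simp]: "adj A $ i $ j = cnj (A $ j $ i)"
  by (simp add: adj_def map_matrix_def transpose_def)

lemma adj_adj [simp]: "adj (adj A) = A"
  by (simp add: vec_eq_iff)

lemma adj_mult: "adj (A ** B) = adj B ** adj A"
  by (simp add: vec_eq_iff matrix_matrix_mult_def mult.commute)

lemma adj_mat1 [simp]: "adj (mat 1) = mat 1"
  by (simp add: vec_eq_iff mat_def)

lemma adj_add: "adj (A + B) = adj A + adj B"
  by (simp add: vec_eq_iff)

lemma adj_diff: "adj (A - B) = adj A - adj B"
  by (simp add: vec_eq_iff)

lemma adj_scaleR: "adj (r *\<^sub>R A) = r *\<^sub>R adj A"
  by (simp add: vec_eq_iff)

lemma adj_scale: "adj (c *\<^sub>M A) = cnj c *\<^sub>M adj A"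
  by (simp add: vec_eq_iff scale_mat_def map_matrix_def)

lemma adj_sum: "adj (\<Sum>i\<in>I. A i) = (\<Sum>i\<in>I. adj (A i))"
  by (simp add: vec_eq_iff)

lemma scale_mat_nth [simp]: "(c *\<^sub>M A) $ i $ j = c * A $ i $ j"
  by (simp add: scale_mat_def map_matrix_def)

lemma scale_mat_mult_left: "(c *\<^sub>M A) ** B = c *\<^sub>M (A ** B)"
  by (simp add: vec_eq_iff matrix_matrix_mult_def sum_distrib_left mult.assoc)

lemma scale_mat_mult_right: "A ** (c *\<^sub>M B) = c *\<^sub>M (A ** B)"
  by (simp add: vec_eq_iff matrix_matrix_mult_def sum_distrib_left algebra_simps)

lemma scaleR_mult_left: "(r *\<^sub>R A) ** (B::'m::finite operator) = r *\<^sub>R (A ** B)"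
  by (simp add: vec_eq_iff matrix_matrix_mult_def scaleR_sum_right)

lemma scaleR_mult_right: "A ** (r *\<^sub>R (B::'m::finite operator)) = r *\<^sub>R (A ** B)"
  by (simp add: vec_eq_iff matrix_matrix_mult_def scaleR_sum_right)

lemma scaleR_eq_scale_mat: "r *\<^sub>R A = of_real r *\<^sub>M A"
  by (simp add: vec_eq_iff) (simp add: scaleR_conv_of_real)

lemma matrix_add_rdistrib: "(A + B) ** (C::'m::finite operator) = A ** C + B ** C"
  by (simp add: vec_eq_iff matrix_matrix_mult_def sum.distrib algebra_simps)

lemma mult_vec_scaleR: "(A::'m::finite operator) *v (r *\<^sub>R v) = r *\<^sub>R (A *v v)"
  by (simp add: vec_eq_iff matrix_vector_mult_def scaleR_sum_right)

lemma scaleR_mult_vec: "(r *\<^sub>R (A::'m::finite operator)) *v v = r *\<^sub>R (A *v v)"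
  by (simp add: vec_eq_iff matrix_vector_mult_def scaleR_sum_right)

lemma mult_vec_scale: "(A::'m::finite operator) *v (c *s v) = c *s (A *v v)"
  by (simp add: vec_eq_iff matrix_vector_mult_def sum_distrib_left algebra_simps)

lemma sum_mult_left: "(\<Sum>i\<in>I. A i) ** (B::'m::finite operator) = (\<Sum>i\<in>I. A i ** B)"
  by (induction I rule: infinite_finite_induct) (simp_all add: matrix_add_rdistrib)

lemma sum_mult_right: "(B::'m::finite operator) ** (\<Sum>i\<in>I. A i) = (\<Sum>i\<in>I. B ** A i)"
  by (induction I rule: infinite_finite_induct) (simp_all add: matrix_add_ldistrib)

lemma diff_mult_left: "(A - B) ** (C::'m::finite operator) = A ** C - B ** C"
  by (simp add: vec_eq_iff matrix_matrix_mult_def sum_subtractf algebra_simps)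

lemma diff_mult_right: "(C::'m::finite operator) ** (A - B) = C ** A - C ** B"
  by (simp add: vec_eq_iff matrix_matrix_mult_def sum_subtractf algebra_simps)

lemma trace_scale: "trace (c *\<^sub>M A) = c * trace A"
  by (simp add: trace_def sum_distrib_left)

lemma trace_scaleR: "trace (r *\<^sub>R (A::'m::finite operator)) = r *\<^sub>R trace A"
  by (simp add: trace_def scaleR_sum_right)

lemma trace_sum: "trace (\<Sum>i\<in>I. (A i::'m::finite operator)) = (\<Sum>i\<in>I. trace (A i))"
  by (simp add: trace_def sum.swap[of _ I])

section \<open>The Hermitian form and its real part\<close>

lemma Re_cinner: "Re (cinner v w) = v \<bullet> w"
  by (simp add: cinner_def inner_vec_def inner_complex_def)

lemma matrix_vector_mult_continuous_on: "continuous_on S (\<lambda>v. (A::'m::finite operator) *v v)"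
  unfolding matrix_vector_mult_def by (intro continuous_intros)

lemma cinner_add_left: "cinner (u + v) w = cinner u w + cinner v w"
  by (simp add: cinner_def algebra_simps sum.distrib)

lemma cinner_add_right: "cinner u (v + w) = cinner u v + cinner u w"
  by (simp add: cinner_def algebra_simps sum.distrib)

lemma cinner_diff_right: "cinner u (v - w) = cinner u v - cinner u w"
  by (simp add: cinner_def algebra_simps sum_subtractf)

lemma cinner_diff_left: "cinner (u - v) w = cinner u w - cinner v w"
  by (simp add: cinner_def algebra_simps sum_subtractf)

lemma cinner_scale_left: "cinner (c *s v) w = cnj c * cinner v w"
  by (simp add: cinner_def sum_distrib_left mult.assoc)

lemma cinner_scale_right: "cinner v (c *s w) = c * cinner v w"
  by (simp add: cinner_def sum_distrib_left algebra_simps)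

lemma cnj_cinner: "cnj (cinner v w) = cinner w v"
  by (simp add: cinner_def mult.commute)

lemma cinner_axis_left: "cinner (axis i 1) w = w $ i"
proof -
  have "cinner (axis i 1) w = (\<Sum>j\<in>UNIV. if j = i then w $ j else 0)"
    unfolding cinner_def by (intro sum.cong) (auto simp: axis_def)
  then show ?thesis by simp
qed

lemma cinner_adj: "cinner v (A *v w) = cinner (adj A *v v) w"
proof -
  have "cinner v (A *v w) = (\<Sum>i\<in>UNIV. \<Sum>j\<in>UNIV. cnj (v $ i) * (A $ i $ j * w $ j))"
    by (simp add: cinner_def matrix_vector_mult_def sum_distrib_left)
  also have "\<dots> = (\<Sum>j\<in>UNIV. \<Sum>i\<in>UNIV. cnj (v $ i) * (A $ i $ j * w $ j))"
    by (rule sum.swap)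
  also have "\<dots> = cinner (adj A *v v) w"
    by (simp add: cinner_def matrix_vector_mult_def sum_distrib_right sum_distrib_left mult_ac)
  finally show ?thesis .
qed

lemma inner_adj: "v \<bullet> (A *v w) = (adj A *v v) \<bullet> (w::complex^'m::finite)"
  by (metis Re_cinner cinner_adj)

lemma cinner_matrix_entry: "cinner (axis i 1) (A *v axis j 1) = A $ i $ j"
  unfolding cinner_axis_left by (simp add: matrix_vector_mult_def axis_def if_distrib cong: if_cong)

text \<open>Polarisation: testing \<open>v + w\<close> makes the sesquilinear form antisymmetric,
  testing \<open>v + \<i> *s w\<close> makes it symmetric. Complex scalars are essential, since a
  real rotation by a right angle has vanishing quadratic form.\<close>

lemma operator_eq_0I:
  fixes B :: "'m::finite operator"
  assumes "\<And>v. cinner v (B *v v) = 0"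
  shows "B = 0"
proof -
  have "cinner v (B *v w) = 0" for v w
  proof -
    have "cinner (v + w) (B *v (v + w)) = 0" by (rule assms)
    then have 1: "cinner v (B *v w) + cinner w (B *v v) = 0"
      by (simp add: matrix_vector_right_distrib cinner_add_left cinner_add_right assms add.commute)
    have "cinner (v + \<i> *s w) (B *v (v + \<i> *s w)) = 0" by (rule assms)
    then have "\<i> * cinner v (B *v w) - \<i> * cinner w (B *v v) = 0"
      by (simp add: matrix_vector_right_distrib cinner_add_left cinner_add_right assms
          mult_vec_scale cinner_scale_left cinner_scale_right)
    then show ?thesis using 1 by (simp add: algebra_simps)
  qed
  then show ?thesis
    by (simp add: vec_eq_iff flip: cinner_matrix_entry)
qed

text \<open>Polarisation applied to \<open>A - adj A\<close> gives self-adjointness. What remains of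
  positivity concerns the real inner product, which makes the Euclidean-space library
  applicable.\<close>

lemma positive_op_iff:
  "positive_op A \<longleftrightarrow> adj A = A \<and> (\<forall>v. 0 \<le> v \<bullet> (A *v v))"
proof
  assume A: "positive_op A"
  have "cinner v ((A - adj A) *v v) = 0" for v
  proof -
    have "cinner v (A *v v) \<in> \<real>\<^sub>\<ge>\<^sub>0" using A by (simp add: positive_op_def)
    then have "cnj (cinner v (A *v v)) = cinner v (A *v v)"
      by (simp add: complex_nonneg_Reals_iff complex_eq_iff)
    moreover have "cinner v (adj A *v v) = cnj (cinner v (A *v v))"
      by (simp add: cinner_adj cnj_cinner)
    ultimately show ?thesis by (simp add: matrix_vector_mult_diff_rdistrib cinner_diff_right)
  qed
  then have "A - adj A = 0" by (rule operator_eq_0I)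
  then show "adj A = A \<and> (\<forall>v. 0 \<le> v \<bullet> (A *v v))"
    using A by (auto simp: positive_op_def complex_nonneg_Reals_iff simp flip: Re_cinner)
next
  assume A: "adj A = A \<and> (\<forall>v. 0 \<le> v \<bullet> (A *v v))"
  show "positive_op A"
    unfolding positive_op_def complex_nonneg_Reals_iff
  proof (intro allI conjI)
    fix v
    show "0 \<le> Re (cinner v (A *v v))" using A by (simp add: Re_cinner)
    have "cnj (cinner v (A *v v)) = cinner v (A *v v)"
      using A by (simp add: cnj_cinner cinner_adj)
    then show "Im (cinner v (A *v v)) = 0" by (simp add: complex_eq_iff)
  qed
qed

lemma positive_op_adj: "positive_op A \<Longrightarrow> adj A = A"
  by (simp add: positive_op_iff)

text \<open>Moving from \<open>v\<close> a small distance against \<open>A *v v\<close> changes the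
  form to first order by a negative amount, which positivity forbids unless \<open>A *v v\<close>
  vanishes.\<close>

lemma positive_op_null:
  assumes A: "positive_op A" and v: "v \<bullet> (A *v v) = 0"
  shows "A *v v = 0"
proof (rule ccontr)
  define w where "w = A *v v"
  define a where "a = w \<bullet> w"
  define b where "b = w \<bullet> (A *v w)"
  assume "A *v v \<noteq> 0"
  then have a: "a > 0" by (simp add: a_def w_def)
  have b: "b \<ge> 0" using A by (simp add: b_def positive_op_iff)
  \<comment> \<open>Small enough that the quadratic term \<open>t * t * b\<close> stays below
    \<open>t * a\<close>; the \<open>+ 1\<close> covers \<open>b = 0\<close>.\<close>
  define t where "t = a / (b + 1)"
  have t: "t > 0" using a b by (simp add: t_def)
  have "v \<bullet> (A *v w) = a"
    using A unfolding a_def w_def by (metis inner_adj positive_op_adj)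
  then have "(v - t *\<^sub>R w) \<bullet> (A *v (v - t *\<^sub>R w)) = - (2 * t * a) + t * t * b"
    using v by (simp add: matrix_vector_mult_diff_distrib mult_vec_scaleR inner_diff inner_commute
        flip: w_def a_def b_def) (simp add: algebra_simps)
  moreover have "(v - t *\<^sub>R w) \<bullet> (A *v (v - t *\<^sub>R w)) \<ge> 0"
    using A by (simp add: positive_op_iff)
  ultimately have "t * (t * b) \<ge> t * (2 * a)" by (simp add: algebra_simps)
  then have "t * b \<ge> 2 * a" using t by simp
  moreover have "t * b \<le> a" using a b by (simp add: t_def field_simps)
  ultimately show False using a by simp
qed

lemma positive_op_0: "positive_op 0"
  by (simp add: positive_op_def cinner_def)

lemma positive_op_add: "positive_op A \<Longrightarrow> positive_op B \<Longrightarrow> positive_op (A + B)"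
  by (simp add: positive_op_iff adj_add matrix_vector_mult_add_rdistrib inner_add_right)

lemma positive_op_sum: "(\<And>i. i \<in> I \<Longrightarrow> positive_op (A i)) \<Longrightarrow> positive_op (\<Sum>i\<in>I. A i)"
  by (induction I rule: infinite_finite_induct) (auto simp: positive_op_0 positive_op_add)

lemma positive_op_scaleR: "positive_op A \<Longrightarrow> 0 \<le> r \<Longrightarrow> positive_op (r *\<^sub>R A)"
  by (simp add: positive_op_iff adj_scaleR scaleR_mult_vec)

lemma positive_op_sandwich:
  assumes "positive_op A" shows "positive_op (C ** A ** adj C)"
proof -
  have "v \<bullet> ((C ** A ** adj C) *v v) = (adj C *v v) \<bullet> (A *v (adj C *v v))" for v
    by (simp add: inner_adj flip: matrix_vector_mul_assoc)
  then show ?thesis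
    using assms by (simp add: positive_op_iff adj_mult matrix_mul_assoc)
qed

section \<open>Rank-one operators and decomposition of positive operators\<close>

definition outer :: "complex^'m \<Rightarrow> 'm::finite operator" where
  "outer v = (\<chi> i j. v $ i * cnj (v $ j))"

lemma outer_nth [simp]: "outer v $ i $ j = v $ i * cnj (v $ j)"
  by (simp add: outer_def)

lemma cinner_outer: "cinner w (outer v *v w) = cnj (cinner v w) * cinner v w"
proof -
  have "outer v *v w = cinner v w *s v"
    by (simp add: vec_eq_iff matrix_vector_mult_def cinner_def sum_distrib_left sum_distrib_right mult_ac)
  then show ?thesis by (simp add: cinner_scale_right cnj_cinner)
qed

lemma positive_op_outer: "positive_op (outer v)"
  by (simp add: positive_op_def cinner_outer complex_nonneg_Reals_iff)

lemma trace_outer: "trace (outer v) = of_real ((norm v)\<^sup>2)"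
proof -
  have "trace (outer v) = cinner v v"
    by (simp add: trace_def cinner_def mult.commute)
  moreover have "Im (cinner v v) = 0"
    by (simp add: cinner_def mult.commute)
  ultimately show ?thesis
    by (simp add: complex_eq_iff Re_cinner power2_norm_eq_inner)
qed

lemma trace_mult_outer: "trace (A ** outer v) = cinner v (A *v v)"
  by (simp add: trace_def cinner_def matrix_matrix_mult_def matrix_vector_mult_def
      sum_distrib_left sum_distrib_right mult_ac)

text \<open>Cholesky factorisation: one Schur complement step clears the diagonal entry at \<open>i\<close>. If that
  entry vanishes, then so does the whole column, and the step is vacuous because \<open>x / 0 = 0\<close>.\<close>
lemma positive_op_decomposition_aux:
  fixes A :: "'m::finite operator"
  assumes "finite S" "positive_op A" "\<And>i. i \<notin> S \<Longrightarrow> A $ i $ i = 0"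
  shows "\<exists>v. A = (\<Sum>i\<in>S. outer (v i))"
  using assms
proof (induction S arbitrary: A rule: finite_induct)
  case empty
  have "A *v axis j 1 = 0" for j
    by (rule positive_op_null) (use empty in \<open>simp_all add: cinner_matrix_entry flip: Re_cinner\<close>)
  then have "A $ i $ j = 0" for i j
    by (metis cinner_matrix_entry cinner_axis_left zero_index)
  then show ?case by (simp add: vec_eq_iff)
next
  case (insert i S)
  define u where "u = A *v axis i 1"
  define a where "a = Re (A $ i $ i)"
  have A: "positive_op A" by fact
  have aii: "A $ i $ i = of_real a" and a0: "0 \<le> a"
    using A cinner_matrix_entry[of i A i]
    by (auto simp: a_def positive_op_def complex_nonneg_Reals_iff complex_eq_iff) (metis)+
  have uj: "u $ j = A $ j $ i" for j
    by (simp add: u_def cinner_matrix_entry flip: cinner_axis_left)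
  have zero_col: "A $ j $ k = 0" if "A $ k $ k = 0" for j k
  proof -
    have "A *v axis k 1 = 0"
      by (rule positive_op_null) (use A that in \<open>simp_all add: cinner_matrix_entry flip: Re_cinner\<close>)
    then show ?thesis by (metis cinner_matrix_entry cinner_axis_left zero_index)
  qed
  define u' where "u' = of_real (1 / sqrt a) *s u"
  have outer_u': "outer u' $ j $ k = u $ j * cnj (u $ k) / of_real a" for j k
  proof -
    have "complex_of_real (1 / sqrt a) * cnj (of_real (1 / sqrt a)) = 1 / of_real a"
      using a0 by (simp flip: of_real_mult)
    moreover have "outer u' $ j $ k
        = (complex_of_real (1 / sqrt a) * cnj (of_real (1 / sqrt a))) * (u $ j * cnj (u $ k))"
      by (simp only: outer_nth u'_def vector_smult_component complex_cnj_mult mult_ac)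
    ultimately show ?thesis by simp
  qed
  have cu: "cinner w u = cnj (cinner u w)" for w by (simp add: cnj_cinner)
  have eu: "cinner (axis i 1) (A *v w) = cinner u w" for w
    using positive_op_adj[OF A] by (simp add: cinner_adj u_def)
  have ua: "cinner u (axis i 1) = of_real a"
    using eu[of "axis i 1"] by (simp add: cinner_matrix_entry aii)
  have "positive_op (A - outer u')"
  proof (cases "a = 0")
    case True
    then have "u = 0" using zero_col aii by (simp add: vec_eq_iff uj)
    then have "A - outer u' = A" by (simp add: vec_eq_iff u'_def)
    then show ?thesis using A by simp
  next
    case False
    show ?thesis unfolding positive_op_def
    proof
      fix w
      define z where "z = cinner u w"
      \<comment> \<open>Completing the square: the form of the Schur complement at \<open>w\<close>
        is the form of \<open>A\<close> at this \<open>x\<close>, the minimiser over shifts of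
        \<open>w\<close> along the basis vector \<open>i\<close>.\<close>
      define x where "x = w - (z / of_real a) *s axis i 1"
      have eq: "cinner u' w = z / of_real (sqrt a)"
        by (simp add: u'_def z_def cinner_scale_left)
      have sa: "complex_of_real (sqrt a) * complex_of_real (sqrt a) = of_real a"
        using a0 by (simp flip: of_real_mult)
      have "cinner w ((A - outer u') *v w) = cinner w (A *v w) - cnj (cinner u' w) * cinner u' w"
        by (simp only: matrix_vector_mult_diff_rdistrib cinner_diff_right cinner_outer)
      also have "\<dots> = cinner w (A *v w) - cnj z * z / of_real a"
        by (simp add: eq sa)
      also have "\<dots> = cinner x (A *v x)"
        using False
        by (simp add: x_def matrix_vector_mult_diff_distrib mult_vec_scale cinner_diff_left
            cinner_diff_right cinner_scale_left cinner_scale_right cinner_matrix_entry eu aii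
            flip: u_def z_def) (simp add: cu ua field_simps flip: z_def)
      also have "\<dots> \<in> \<real>\<^sub>\<ge>\<^sub>0" using A by (simp add: positive_op_def)
      finally show "cinner w ((A - outer u') *v w) \<in> \<real>\<^sub>\<ge>\<^sub>0" .
    qed
  qed
  moreover have "(A - outer u') $ j $ j = 0" if "j \<notin> S" for j
  proof (cases "j = i")
    case True
    then show ?thesis by (simp add: outer_u' uj aii del: outer_nth)
  next
    case False
    then have ajj: "A $ j $ j = 0" using insert.prems that by simp
    have "A $ j $ i = cnj (A $ i $ j)"
      using adj_nth[of A j i] positive_op_adj[OF A] by simp
    then have "u $ j = 0"
      using zero_col[OF ajj, of i] uj by simp
    then show ?thesis using ajj by (simp add: outer_u' del: outer_nth)
  qed
  ultimately obtain v where v: "A - outer u' = (\<Sum>i\<in>S. outer (v i))"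
    using insert.IH by blast
  have "(\<Sum>k\<in>S. outer ((v(i := u')) k)) = (\<Sum>k\<in>S. outer (v k))"
    using insert.hyps by (intro sum.cong) auto
  then have "A = (\<Sum>k\<in>insert i S. outer ((v(i := u')) k))"
    using insert.hyps v by (simp add: algebra_simps)
  then show ?case by blast
qed

lemma positive_op_decomposition:
  fixes A :: "'m::finite operator"
  assumes "positive_op A"
  obtains v :: "'m \<Rightarrow> complex^'m" where "A = (\<Sum>i\<in>UNIV. outer (v i))"
  using positive_op_decomposition_aux[of UNIV A] assms by auto

lemma trace_mult_positive:
  fixes A B :: "'m::finite operator"
  assumes "positive_op A" "positive_op B"
  shows "trace (A ** B) \<in> \<real>\<^sub>\<ge>\<^sub>0"
proof -
  obtain v :: "'m \<Rightarrow> complex^'m" where "B = (\<Sum>i\<in>UNIV. outer (v i))"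
    using positive_op_decomposition[OF assms(2)] .
  then have "trace (A ** B) = (\<Sum>i\<in>UNIV. cinner (v i) (A *v v i))"
    by (simp add: sum_mult_right trace_sum trace_mult_outer)
  then show ?thesis
    using assms(1) by (auto simp: positive_op_def complex_nonneg_Reals_iff intro!: sum_nonneg)
qed

text \<open>A minimiser \<open>v\<close> of the quadratic form of \<open>A ** B\<close> on the unit sphere is an eigenvector. If its
  eigenvalue \<open>l\<close> were negative, then \<open>0 \<le> (B *v v) \<bullet> (A *v (B *v v)) = l * (v \<bullet> (B *v v)) \<le> 0\<close>
  would force \<open>B *v v = 0\<close>.\<close>
lemma positive_op_mult_commute:
  fixes A B :: "'m::finite operator"
  assumes A: "positive_op A" and B: "positive_op B" and com: "A ** B = B ** A"
  shows "positive_op (A ** B)"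
proof (rule ccontr)
  assume neg: "\<not> positive_op (A ** B)"
  define C where "C = A ** B"
  have C: "adj C = C" using A B com by (simp add: C_def adj_mult positive_op_adj)
  have "compact (sphere (0::complex^'m) 1)" by simp
  moreover have "(axis undefined 1 :: complex^'m) \<in> sphere 0 1" by (simp add: norm_axis_1)
  then have "sphere (0::complex^'m) 1 \<noteq> {}" by blast
  moreover have "continuous_on (sphere 0 1) (\<lambda>v. v \<bullet> (C *v v))"
    by (intro continuous_on_inner continuous_on_id matrix_vector_mult_continuous_on)
  ultimately obtain v where v: "v \<in> sphere 0 1"
      and min: "\<And>w. w \<in> sphere 0 1 \<Longrightarrow> v \<bullet> (C *v v) \<le> w \<bullet> (C *v w)"
    using continuous_attains_inf[of "sphere 0 1" "\<lambda>v. v \<bullet> (C *v v)"] by blast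
  define l where "l = v \<bullet> (C *v v)"
  have scaled: "l * (w \<bullet> w) \<le> w \<bullet> (C *v w)" for w
  proof (cases "w = 0")
    case False
    define w' where "w' = (1 / norm w) *\<^sub>R w"
    have "w' \<in> sphere 0 1" using False by (simp add: w'_def)
    then have "l \<le> w' \<bullet> (C *v w')" using min l_def by blast
    also have "\<dots> = (w \<bullet> (C *v w)) / (w \<bullet> w)"
      by (simp add: w'_def mult_vec_scaleR power2_eq_square flip: power2_norm_eq_inner)
    finally show ?thesis using False by (simp add: pos_le_divide_eq)
  qed simp
  have D: "(C - l *\<^sub>R mat 1) *v w = C *v w - l *\<^sub>R w" for w
    by (simp add: matrix_vector_mult_diff_rdistrib scaleR_mult_vec)
  \<comment> \<open>After shifting by the minimum the form is nonnegative and vanishes at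
    \<open>v\<close>, so \<open>positive_op_null\<close> yields the eigenvector equation without
    Lagrange multipliers.\<close>
  have "positive_op (C - l *\<^sub>R mat 1)"
    using C scaled by (simp add: positive_op_iff adj_diff adj_scaleR D inner_diff_right)
  moreover have "v \<bullet> ((C - l *\<^sub>R mat 1) *v v) = 0"
    using v unfolding D by (simp add: inner_diff_right flip: power2_norm_eq_inner l_def)
  ultimately have "(C - l *\<^sub>R mat 1) *v v = 0" by (rule positive_op_null)
  then have eig: "C *v v = l *\<^sub>R v" by (simp add: D)
  obtain w where "w \<bullet> (C *v w) < 0"
    using neg C unfolding C_def[symmetric] positive_op_iff not_le[symmetric] by blast
  then have "l * (w \<bullet> w) < 0" using scaled[of w] by linarith
  then have l: "l < 0" using mult_nonneg_nonneg[OF _ inner_ge_zero, of l w] by linarith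
  have "A *v (B *v v) = l *\<^sub>R v"
    using eig unfolding C_def matrix_vector_mul_assoc .
  then have "(B *v v) \<bullet> (A *v (B *v v)) = l * (v \<bullet> (B *v v))"
    by (metis inner_commute inner_scaleR_right)
  moreover have "(B *v v) \<bullet> (A *v (B *v v)) \<ge> 0" "v \<bullet> (B *v v) \<ge> 0"
    using A B by (simp_all add: positive_op_iff)
  ultimately have "v \<bullet> (B *v v) = 0"
    using l mult_neg_pos[of l "v \<bullet> (B *v v)"] by linarith
  then have "B *v v = 0" using B positive_op_null by blast
  then have "l *\<^sub>R v = 0" using \<open>A *v (B *v v) = l *\<^sub>R v\<close> by simp
  then show False using v l by auto
qed

section \<open>Tensor powers\<close>

lemma tensor_nth [simp]: "tensor A $ f $ g = (\<Prod>k\<in>UNIV. A k $ f k $ g k)"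
  by (simp add: tensor_def)

lemma prod_sum_fun:
  fixes a :: "'n::finite \<Rightarrow> 'i \<Rightarrow> 'c::comm_semiring_1"
  assumes "finite I"
  shows "(\<Prod>k\<in>UNIV. \<Sum>i\<in>I. a k i) = (\<Sum>h\<in>UNIV \<rightarrow>\<^sub>E I. \<Prod>k\<in>UNIV. a k (h k))"
  by (rule prod_sum_PiE) (use assms in auto)

lemma tensor_mult: "tensor A ** tensor B = tensor (\<lambda>k. A k ** B k)"
  by (simp add: vec_eq_iff matrix_matrix_mult_def prod_sum_fun prod.distrib)

lemma adj_tensor: "adj (tensor A) = tensor (\<lambda>k. adj (A k))"
  by (simp add: vec_eq_iff)

lemma tensor_mat1 [simp]: "tensor (\<lambda>_. mat 1) = mat 1"
  by (auto simp: vec_eq_iff mat_def fun_eq_iff)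

lemma tensor_sum:
  assumes "finite I"
  shows "tensor (\<lambda>k. \<Sum>i\<in>I. A k i) = (\<Sum>h\<in>UNIV \<rightarrow>\<^sub>E I. tensor (\<lambda>k. A k (h k)))"
  using assms by (simp add: vec_eq_iff prod_sum_fun)

lemma trace_tensor: "trace (tensor A) = (\<Prod>k\<in>UNIV. trace (A k))"
  by (simp add: trace_def prod_sum_fun)

lemma tensor_power_conj_by:
  "tensor_power (conj_by V A) = conj_by (tensor_power V) (tensor_power A)"
  by (simp add: tensor_power_def conj_by_def adj_tensor tensor_mult)

definition matrix_unit :: "'m \<Rightarrow> 'm \<Rightarrow> 'm::finite operator" where
  "matrix_unit i j = (\<chi> a b. if a = i \<and> b = j then 1 else 0)"

lemma matrix_unit_nth [simp]: "matrix_unit i j $ a $ b = (if a = i \<and> b = j then 1 else 0)"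
  by (simp add: matrix_unit_def)

text \<open>Every operator on the tensor power is thus a combination of product tensors, so linear
  maps there can be computed and compared on product tensors alone.\<close>

lemma tensor_matrix_unit:
  "tensor (\<lambda>k. matrix_unit (f k) (g k)) = matrix_unit f g"
proof -
  have "(\<Prod>k\<in>UNIV. if h k = f k \<and> h' k = g k then 1 else 0) =
      (if h = f \<and> h' = g then 1 else (0::complex))" for h h'
    by (auto simp: fun_eq_iff)
  then show ?thesis by (simp add: vec_eq_iff)
qed

lemma operator_expand: "X = (\<Sum>i\<in>UNIV. \<Sum>j\<in>UNIV. X $ i $ j *\<^sub>M matrix_unit i j)"
proof -
  have "(\<Sum>j\<in>UNIV. X $ i $ j * (if a = i \<and> b = j then 1 else 0)) = (if i = a then X $ i $ b else 0)"
    for a b i by (simp add: mult_delta_right)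
  then have "(\<Sum>i\<in>UNIV. \<Sum>j\<in>UNIV. X $ i $ j *\<^sub>M matrix_unit i j) $ a $ b = X $ a $ b" for a b
    by simp
  then show ?thesis by (simp add: vec_eq_iff)
qed

section \<open>Complex-linear maps and the tensor power of an algebra\<close>

abbreviation clinear :: "('m::finite operator \<Rightarrow> 'k::finite operator) \<Rightarrow> bool" where
  "clinear \<equiv> Vector_Spaces.linear (*\<^sub>M) (*\<^sub>M)"

lemma clinearI:
  assumes "\<And>X Y. F (X + Y) = F X + F Y" "\<And>c X. F (c *\<^sub>M X) = c *\<^sub>M F X"
  shows "clinear F"
  using assms
  by (simp add: Vector_Spaces.linear_def module_hom_def module_hom_axioms_def
      mat_space.vector_space_axioms mat_space.module_axioms)

lemma clinear_add: "clinear F \<Longrightarrow> F (X + Y) = F X + F Y"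
  by (simp add: Vector_Spaces.linear_def module_hom_def module_hom_axioms_def)

lemma clinear_scale: "clinear F \<Longrightarrow> F (c *\<^sub>M X) = c *\<^sub>M F X"
  by (simp add: Vector_Spaces.linear_def module_hom_def module_hom_axioms_def)

lemma clinear_0: "clinear F \<Longrightarrow> F 0 = 0"
  using clinear_scale[of F 0 0] by simp

lemma clinear_sum: "clinear F \<Longrightarrow> F (\<Sum>i\<in>I. X i) = (\<Sum>i\<in>I. F (X i))"
  by (induction I rule: infinite_finite_induct) (auto simp: clinear_add clinear_0)

lemma clinear_imp_linear: "clinear F \<Longrightarrow> linear F"
  by (rule linearI) (simp_all add: clinear_add clinear_scale scaleR_eq_scale_mat)

lemma clinear_imp_bounded_linear: "clinear F \<Longrightarrow> bounded_linear F"
  by (simp add: clinear_imp_linear linear_conv_bounded_linear[symmetric])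

lemma clinear_expand:
  assumes "clinear F"
  shows "F X = (\<Sum>i\<in>UNIV. \<Sum>j\<in>UNIV. X $ i $ j *\<^sub>M F (matrix_unit i j))"
  by (subst operator_expand[of X]) (simp add: clinear_sum clinear_scale assms)

lemma tensor_in_algebra: "(\<And>k. A k \<in> \<A>) \<Longrightarrow> tensor A \<in> algebra_tensor_power \<A>"
  unfolding algebra_tensor_power_def by (rule mat_space.span_base) auto

lemma subspace_algebra_tensor_power: "mat_space.subspace (algebra_tensor_power \<A>)"
  by (simp add: algebra_tensor_power_def)

lemmas algebra_tensor_power_add = mat_space.subspace_add[OF subspace_algebra_tensor_power]
lemmas algebra_tensor_power_diff = mat_space.subspace_diff[OF subspace_algebra_tensor_power]
lemmas algebra_tensor_power_scale = mat_space.subspace_scale[OF subspace_algebra_tensor_power]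
lemmas algebra_tensor_power_sum = mat_space.subspace_sum[OF subspace_algebra_tensor_power]

lemma algebra_tensor_power_scaleR:
  "a \<in> algebra_tensor_power \<A> \<Longrightarrow> r *\<^sub>R a \<in> algebra_tensor_power \<A>"
  by (simp add: scaleR_eq_scale_mat algebra_tensor_power_scale)

lemma algebra_tensor_power_induct [consumes 1, case_names zero add scale tensor]:
  assumes "a \<in> algebra_tensor_power \<A>" and "P 0"
    and "\<And>x y. P x \<Longrightarrow> P y \<Longrightarrow> P (x + y)" and "\<And>c x. P x \<Longrightarrow> P (c *\<^sub>M x)"
    and "\<And>A. (\<And>k. A k \<in> \<A>) \<Longrightarrow> P (tensor A)"
  shows "P a"
proof -
  have "mat_space.subspace (Collect P)"
    by (rule mat_space.subspaceI) (use assms in auto)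
  with assms(1) show ?thesis
    unfolding algebra_tensor_power_def
    by (rule mat_space.span_induct) (use assms(5) in auto)
qed

lemma algebra_tensor_power_mult:
  assumes "von_neumann_algebra \<A>" "a \<in> algebra_tensor_power \<A>" "b \<in> algebra_tensor_power \<A>"
  shows "a ** b \<in> algebra_tensor_power \<A>"
  using assms(2)
proof (induction rule: algebra_tensor_power_induct)
  case zero
  then show ?case using mat_space.subspace_0[OF subspace_algebra_tensor_power] by simp
next
  case (add x y)
  then show ?case by (simp add: matrix_add_rdistrib algebra_tensor_power_add)
next
  case (scale c x)
  then show ?case by (simp add: scale_mat_mult_left algebra_tensor_power_scale)
next
  case (tensor A)
  show ?case
    using assms(3)
  proof (induction rule: algebra_tensor_power_induct)
    case zero
    then show ?case using mat_space.subspace_0[OF subspace_algebra_tensor_power] by simp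
  next
    case (add x y)
    then show ?case by (simp add: matrix_add_ldistrib algebra_tensor_power_add)
  next
    case (scale c x)
    then show ?case by (simp add: scale_mat_mult_right algebra_tensor_power_scale)
  next
    case (tensor B)
    then show ?case
      using assms(1) \<open>\<And>k. A k \<in> \<A>\<close>
      by (auto simp: tensor_mult von_neumann_algebra_def intro!: tensor_in_algebra)
  qed
qed

lemma adj_0: "adj 0 = 0"
  by (simp add: vec_eq_iff)

lemma algebra_tensor_power_adj:
  assumes "von_neumann_algebra \<A>" "a \<in> algebra_tensor_power \<A>"
  shows "adj a \<in> algebra_tensor_power \<A>"
  using assms(2)
proof (induction rule: algebra_tensor_power_induct)
  case zero
  then show ?case
    using mat_space.subspace_0[OF subspace_algebra_tensor_power] by (simp add: adj_0)
next
  case (add x y)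
  then show ?case by (simp add: adj_add algebra_tensor_power_add)
next
  case (scale c x)
  then show ?case by (simp add: adj_scale algebra_tensor_power_scale)
next
  case (tensor A)
  then show ?case
    using assms(1) by (auto simp: adj_tensor von_neumann_algebra_def intro!: tensor_in_algebra)
qed

lemma algebra_tensor_power_1: "von_neumann_algebra \<A> \<Longrightarrow> mat 1 \<in> algebra_tensor_power \<A>"
  using tensor_in_algebra[of "\<lambda>_. mat 1" \<A>] by (simp add: von_neumann_algebra_def)

subsection \<open>Kraus maps\<close>

definition kraus_map :: "'i set \<Rightarrow> ('i \<Rightarrow> 'm::finite operator) \<Rightarrow> 'm operator \<Rightarrow> 'm operator" where
  "kraus_map I K X = (\<Sum>i\<in>I. K i ** X ** adj (K i))"

text \<open>The n-fold tensor power of \<open>kraus_map I K\<close>: a product Kraus operator arises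
  from each choice \<open>h\<close> of one Kraus index per factor. In this form its positivity is
  immediate.\<close>

definition tensor_kraus_map ::
  "'i set \<Rightarrow> ('i \<Rightarrow> 'd::finite operator) \<Rightarrow> ('n::finite \<Rightarrow> 'd) operator \<Rightarrow> ('n \<Rightarrow> 'd) operator" where
  "tensor_kraus_map I K = kraus_map (UNIV \<rightarrow>\<^sub>E I) (\<lambda>h. tensor (\<lambda>k. K (h k)))"

lemma clinear_kraus_map: "clinear (kraus_map I K)"
  by (rule clinearI)
    (simp_all add: kraus_map_def matrix_add_ldistrib matrix_add_rdistrib sum.distrib
      scale_mat_mult_left scale_mat_mult_right mat_space.scale_sum_right)

lemma clinear_tensor_kraus_map: "clinear (tensor_kraus_map I K)"
  unfolding tensor_kraus_map_def by (rule clinear_kraus_map)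

lemma positive_kraus_map: "positive_op X \<Longrightarrow> positive_op (kraus_map I K X)"
  by (simp add: kraus_map_def positive_op_sum positive_op_sandwich)

lemma tensor_kraus_map_tensor:
  "finite I \<Longrightarrow> tensor_kraus_map I K (tensor A) = tensor (\<lambda>k. kraus_map I K (A k))"
  by (simp add: tensor_kraus_map_def kraus_map_def adj_tensor tensor_mult tensor_sum)

text \<open>The right-hand side depends on \<open>K\<close> only through the one-factor map. Hence
  two Kraus families of the same map have the same tensor power, and properties of one-factor values
  pass to all values.\<close>

lemma tensor_kraus_map_expand:
  assumes "finite I"
  shows "tensor_kraus_map I K X =
    (\<Sum>f\<in>UNIV. \<Sum>g\<in>UNIV. X $ f $ g *\<^sub>M tensor (\<lambda>k. kraus_map I K (matrix_unit (f k) (g k))))"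
  by (subst clinear_expand[OF clinear_tensor_kraus_map])
    (simp add: assms tensor_kraus_map_tensor flip: tensor_matrix_unit)

lemma trace_tensor_kraus_map:
  assumes "finite I" "\<And>X. trace (kraus_map I K X) = trace X"
  shows "trace (tensor_kraus_map I K X) = trace X"
proof -
  have "trace (tensor_kraus_map I K X)
      = (\<Sum>f\<in>UNIV. \<Sum>g\<in>UNIV. X $ f $ g * (\<Prod>k\<in>UNIV. trace (matrix_unit (f k) (g k))))"
    by (simp add: tensor_kraus_map_expand assms trace_sum trace_scale trace_tensor)
  also have "\<dots> = trace (\<Sum>f\<in>UNIV. \<Sum>g\<in>UNIV. X $ f $ g *\<^sub>M matrix_unit f g)"
    by (simp only: trace_sum trace_scale trace_tensor flip: tensor_matrix_unit)
  finally show ?thesis by (simp flip: operator_expand)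
qed

subsection \<open>The symmetric subspace\<close>

text \<open>The basis vector \<open>g\<close> goes to \<open>g \<circ> \<sigma>\<close>. With this
  convention products reverse the order of composition.\<close>

definition perm_op :: "('n \<Rightarrow> 'n) \<Rightarrow> ('n::finite \<Rightarrow> 'd::finite) operator" where
  "perm_op \<sigma> = (\<chi> f g. if f = g \<circ> \<sigma> then 1 else 0)"

definition sym_proj :: "('n::finite \<Rightarrow> 'd::finite) operator" where
  "sym_proj = (1 / fact CARD('n)) *\<^sub>R (\<Sum>\<sigma> | \<sigma> permutes (UNIV :: 'n set). perm_op \<sigma>)"

lemma comp_permutes_eq_iff:
  assumes "\<sigma> permutes UNIV"
  shows "f = g \<circ> \<sigma> \<longleftrightarrow> g = f \<circ> inv \<sigma>"
  using permutes_inv_o[OF assms] by (auto simp: comp_assoc)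

lemma perm_op_mult_nth:
  assumes "\<sigma> permutes (UNIV :: 'n::finite set)"
  shows "(perm_op \<sigma> ** X) $ f $ g = X $ (f \<circ> inv \<sigma>) $ g"
  unfolding matrix_matrix_mult_def perm_op_def
  by (simp add: comp_permutes_eq_iff[OF assms] mult_delta_left)

lemma mult_perm_op_nth: "(X ** perm_op \<sigma>) $ f $ g = X $ f $ (g \<circ> \<sigma>)"
  unfolding matrix_matrix_mult_def perm_op_def by (simp add: mult_delta_right)

lemma perm_op_tensor:
  assumes "\<sigma> permutes (UNIV :: 'n::finite set)"
  shows "perm_op \<sigma> ** tensor A = tensor (A \<circ> \<sigma>) ** perm_op \<sigma>"
proof -
  have "(\<Prod>k\<in>UNIV. A k $ f (inv \<sigma> k) $ g k) = (\<Prod>k\<in>UNIV. A (\<sigma> k) $ f k $ g (\<sigma> k))" for f g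
    using prod.permute[OF assms, of "\<lambda>k. A k $ f (inv \<sigma> k) $ g k"] permutes_inverses(2)[OF assms]
    by (simp add: comp_def)
  then show ?thesis
    by (simp add: vec_eq_iff perm_op_mult_nth[OF assms] mult_perm_op_nth)
qed

lemma perm_op_mult:
  "perm_op \<sigma> ** perm_op \<tau> = perm_op (\<tau> \<circ> \<sigma>)" if "\<sigma> permutes (UNIV::'n::finite set)"
  using comp_permutes_eq_iff[OF that]
  by (simp add: vec_eq_iff mult_perm_op_nth) (simp add: perm_op_def comp_assoc)

lemma adj_perm_op:
  assumes "\<sigma> permutes (UNIV :: 'n::finite set)"
  shows "adj (perm_op \<sigma>) = perm_op (inv \<sigma>)"
  using comp_permutes_eq_iff[OF assms] by (auto simp: vec_eq_iff perm_op_def)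

lemma perm_op_sym_proj:
  assumes "\<sigma> permutes (UNIV :: 'n::finite set)"
  shows "perm_op \<sigma> ** sym_proj = sym_proj" and "sym_proj ** perm_op \<sigma> = sym_proj"
proof -
  have "(\<Sum>\<tau> | \<tau> permutes UNIV. perm_op \<sigma> ** perm_op \<tau>) = (\<Sum>\<tau> | \<tau> permutes UNIV. perm_op (\<tau> \<circ> \<sigma>))"
    by (simp add: perm_op_mult[OF assms])
  also have "\<dots> = (\<Sum>\<tau> | \<tau> permutes UNIV. perm_op \<tau>)"
    by (rule sum_permutations_compose_right[OF assms, symmetric])
  finally show "perm_op \<sigma> ** sym_proj = sym_proj"
    by (simp add: sym_proj_def scaleR_mult_right sum_mult_right)
  have "(\<Sum>\<tau> | \<tau> permutes UNIV. perm_op \<tau> ** perm_op \<sigma>) = (\<Sum>\<tau> | \<tau> permutes UNIV. perm_op (\<sigma> \<circ> \<tau>))"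
    by (intro sum.cong) (simp_all add: perm_op_mult)
  also have "\<dots> = (\<Sum>\<tau> | \<tau> permutes UNIV. perm_op \<tau>)"
    by (rule setum_permutations_compose_left[OF assms, symmetric])
  finally show "sym_proj ** perm_op \<sigma> = sym_proj"
    by (simp add: sym_proj_def scaleR_mult_left sum_mult_left)
qed

lemma sym_proj_mult_eqI:
  fixes X :: "('n::finite \<Rightarrow> 'd::finite) operator"
  assumes "\<And>\<sigma>. \<sigma> permutes UNIV \<Longrightarrow> perm_op \<sigma> ** X = Y"
  shows "sym_proj ** X = Y"
proof -
  have "sym_proj ** X = (1 / fact CARD('n)) *\<^sub>R (\<Sum>\<sigma> | \<sigma> permutes (UNIV :: 'n set). Y)"
    using assms by (simp add: sym_proj_def scaleR_mult_left sum_mult_left)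
  also have "(\<Sum>\<sigma> | \<sigma> permutes (UNIV :: 'n set). Y) = fact CARD('n) *\<^sub>R Y"
    by (simp add: card_permutations[OF refl] sum_constant_scaleR del: sum_constant)
  finally show ?thesis by simp
qed

lemma sym_proj_idem: "sym_proj ** sym_proj = sym_proj"
  by (rule sym_proj_mult_eqI) (rule perm_op_sym_proj)

lemma adj_sym_proj: "adj sym_proj = sym_proj"
proof -
  have "(\<Sum>\<sigma> | \<sigma> permutes (UNIV :: 'n set). adj (perm_op \<sigma> :: ('n::finite \<Rightarrow> 'd::finite) operator))
      = (\<Sum>\<sigma> | \<sigma> permutes UNIV. perm_op (inv \<sigma>))"
    by (intro sum.cong) (auto simp: adj_perm_op)
  also have "\<dots> = (\<Sum>\<sigma> | \<sigma> permutes UNIV. perm_op \<sigma>)"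
    by (rule sum_permutations_inverse[symmetric])
  finally show ?thesis by (simp add: sym_proj_def adj_scaleR adj_sum)
qed

lemma commute_sym_projI:
  fixes X :: "('n::finite \<Rightarrow> 'd::finite) operator"
  assumes "\<And>\<sigma>. \<sigma> permutes UNIV \<Longrightarrow> perm_op \<sigma> ** X = X ** perm_op \<sigma>"
  shows "sym_proj ** X = X ** sym_proj"
  using assms
  by (simp add: sym_proj_def scaleR_mult_left scaleR_mult_right sum_mult_left sum_mult_right)

lemma sym_proj_tensor_power: "sym_proj ** tensor_power A = tensor_power A ** sym_proj"
  by (rule commute_sym_projI) (simp add: tensor_power_def perm_op_tensor comp_def)

text \<open>This is where purity enters. The row dependence of a power of a pure state is a product
  of the same function over all factors, hence invariant under permuting rows alone; for a mixed
  state only simultaneous permutation of rows and columns is harmless.\<close>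

lemma sym_proj_pure:
  fixes \<psi> :: "complex^'d::finite"
  shows "sym_proj ** (tensor_power (outer \<psi>) :: ('n::finite \<Rightarrow> 'd) operator) = tensor_power (outer \<psi>)"
proof (rule sym_proj_mult_eqI)
  fix \<sigma> :: "'n \<Rightarrow> 'n" assume \<sigma>: "\<sigma> permutes UNIV"
  have "(\<Prod>k\<in>UNIV. \<psi> $ f (inv \<sigma> k)) = (\<Prod>k\<in>UNIV. \<psi> $ f k)" for f
    using prod.permute[OF permutes_inv[OF \<sigma>], of "\<lambda>k. \<psi> $ f k"] by (simp add: comp_def)
  then show "perm_op \<sigma> ** tensor_power (outer \<psi>) = tensor_power (outer \<psi>)"
    by (simp add: vec_eq_iff perm_op_mult_nth[OF \<sigma>] tensor_power_def prod.distrib)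
qed

section \<open>Commutants\<close>

lemma inner_op: "A \<bullet> B = Re (trace (adj A ** (B::'m::finite operator)))"
proof -
  have "A \<bullet> B = (\<Sum>i\<in>UNIV. \<Sum>j\<in>UNIV. A $ i $ j \<bullet> B $ i $ j)"
    by (simp add: inner_vec_def)
  also have "\<dots> = (\<Sum>j\<in>UNIV. \<Sum>i\<in>UNIV. A $ i $ j \<bullet> B $ i $ j)"
    by (rule sum.swap)
  finally show ?thesis
    by (simp add: trace_def matrix_matrix_mult_def inner_complex_def)
qed

lemma inner_op_mult_left: "(Z ** Y) \<bullet> W = Y \<bullet> (adj Z ** (W::'m::finite operator))"
  by (simp add: inner_op adj_mult matrix_mul_assoc)

lemma inner_op_mult_right: "(Y ** Z) \<bullet> W = Y \<bullet> ((W::'m::finite operator) ** adj Z)"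
proof -
  have "trace (adj Z ** (adj Y ** W)) = trace (adj Y ** (W ** adj Z))"
    by (metis matrix_mul_assoc trace_mul_sym)
  then show ?thesis by (simp add: inner_op adj_mult matrix_mul_assoc)
qed

lemma inner_adj_left: "adj A \<bullet> B = A \<bullet> adj (B::'m::finite operator)"
proof -
  have "adj A \<bullet> B = (\<Sum>i\<in>UNIV. \<Sum>j\<in>UNIV. cnj (A $ j $ i) \<bullet> B $ i $ j)"
    by (simp add: inner_vec_def)
  also have "\<dots> = (\<Sum>j\<in>UNIV. \<Sum>i\<in>UNIV. cnj (A $ j $ i) \<bullet> B $ i $ j)"
    by (rule sum.swap)
  finally show ?thesis
    by (simp add: inner_vec_def inner_complex_def)
qed

lemma inner_scale_left: "(c *\<^sub>M A) \<bullet> B = A \<bullet> (cnj c *\<^sub>M (B::'m::finite operator))"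
  by (simp add: inner_op adj_scale scale_mat_mult_left scale_mat_mult_right)

section \<open>Commutants, the double commutant and Casimir maps\<close>

definition commutant :: "'m::finite operator set \<Rightarrow> 'm operator set" where
  "commutant S = {Y. \<forall>A\<in>S. Y ** A = A ** Y}"

lemma commutant_add: "Y \<in> commutant S \<Longrightarrow> Z \<in> commutant S \<Longrightarrow> Y + Z \<in> commutant S"
  by (simp add: commutant_def matrix_add_ldistrib matrix_add_rdistrib)

lemma commutant_scale: "Y \<in> commutant S \<Longrightarrow> c *\<^sub>M Y \<in> commutant S"
  by (simp add: commutant_def scale_mat_mult_left scale_mat_mult_right)

lemma commutant_scaleR: "Y \<in> commutant S \<Longrightarrow> r *\<^sub>R Y \<in> commutant S"
  by (simp add: scaleR_eq_scale_mat commutant_scale)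

lemma commutant_0: "0 \<in> commutant S"
  using diff_mult_left[of 0 0] by (simp add: commutant_def vec_eq_iff matrix_matrix_mult_def)

lemma commutant_mat1: "mat 1 \<in> commutant S"
  by (simp add: commutant_def)

lemma commutant_diff: "Y \<in> commutant S \<Longrightarrow> Z \<in> commutant S \<Longrightarrow> Y - Z \<in> commutant S"
  by (simp add: commutant_def diff_mult_left diff_mult_right)

lemma commutant_mult: "Y \<in> commutant S \<Longrightarrow> Z \<in> commutant S \<Longrightarrow> Y ** Z \<in> commutant S"
  by (simp add: commutant_def) (metis matrix_mul_assoc)

lemma commutant_adj:
  assumes "von_neumann_algebra \<A>" "Y \<in> commutant \<A>"
  shows "adj Y \<in> commutant \<A>"
  unfolding commutant_def
proof (intro CollectI ballI)
  fix A assume "A \<in> \<A>"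
  then have "adj A \<in> \<A>" using assms(1) by (simp add: von_neumann_algebra_def)
  then have "adj (Y ** adj A) = adj (adj A ** Y)" using assms(2) by (simp add: commutant_def)
  then show "adj Y ** A = A ** adj Y" by (simp add: adj_mult)
qed

lemma commutant_subspace: "subspace (commutant S)"
  by (simp add: subspace_def commutant_0 commutant_add commutant_scaleR)

text \<open>The Hilbert-Schmidt projection onto \<open>\<A>\<close> commutes with left multiplication by \<open>\<A>\<close>, so its
  blocks lie in the commutant. Hence it also commutes with left multiplication by \<open>X\<close>, which
  yields \<open>X\<close> as the image of \<open>X ** mat 1\<close>.\<close>
lemma double_commutant:
  fixes \<A> :: "'m::finite operator set"
  assumes \<A>: "von_neumann_algebra \<A>" and X: "X \<in> commutant (commutant \<A>)"
  shows "X \<in> \<A>"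
proof -
  have sub: "mat_space.subspace \<A>" using \<A> by (simp add: von_neumann_algebra_def)
  have rsub: "subspace \<A>"
    using mat_space.subspace_0[OF sub] mat_space.subspace_add[OF sub] mat_space.subspace_scale[OF sub]
    by (simp add: subspace_def scaleR_eq_scale_mat)
  define proj where "proj M = (SOME P. P \<in> \<A> \<and> (\<forall>b\<in>\<A>. (M - P) \<bullet> b = 0))" for M
  have proj: "proj M \<in> \<A>" "b \<in> \<A> \<Longrightarrow> (M - proj M) \<bullet> b = 0" for M b
  proof -
    obtain y z where "y \<in> span \<A>" "\<And>w. w \<in> span \<A> \<Longrightarrow> orthogonal z w" "M = y + z"
      using orthogonal_subspace_decomp_exists[of \<A> M] by blast
    then have "y \<in> \<A> \<and> (\<forall>b\<in>\<A>. (M - y) \<bullet> b = 0)"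
      using rsub by (simp add: span_eq_iff[THEN iffD2] orthogonal_def)
    then have "proj M \<in> \<A> \<and> (\<forall>b\<in>\<A>. (M - proj M) \<bullet> b = 0)"
      unfolding proj_def by (rule someI)
    then show "proj M \<in> \<A>" "b \<in> \<A> \<Longrightarrow> (M - proj M) \<bullet> b = 0" by auto
  qed
  have proj_eqI: "proj M = P" if "P \<in> \<A>" "\<And>b. b \<in> \<A> \<Longrightarrow> (M - P) \<bullet> b = 0" for M P
  proof -
    have "P - proj M \<in> \<A>" using that proj mat_space.subspace_diff[OF sub] by blast
    then have "(M - proj M) \<bullet> (P - proj M) - (M - P) \<bullet> (P - proj M) = 0"
      using that proj by simp
    then have "(P - proj M) \<bullet> (P - proj M) = 0" by (simp flip: inner_diff_left)
    then show ?thesis by simp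
  qed
  have proj_add: "proj (M + N) = proj M + proj N" for M N
    by (rule proj_eqI) (use proj mat_space.subspace_add[OF sub] in
      \<open>auto simp: add_diff_add inner_add_left\<close>)
  \<comment> \<open>Orthogonality is real here, but \<A> is closed under complex scalars, so a
    factor can be moved to the other argument. Thus the projection is complex linear.\<close>
  have proj_scale: "proj (c *\<^sub>M M) = c *\<^sub>M proj M" for c M
    by (rule proj_eqI) (use proj mat_space.subspace_scale[OF sub] in
      \<open>auto simp: inner_scale_left simp flip: mat_space.scale_right_diff_distrib\<close>)
  have lin: "clinear proj" by (rule clinearI) (fact proj_add proj_scale)+
  have proj_mult: "proj (a ** M) = a ** proj M" if "a \<in> \<A>" for a M
    by (rule proj_eqI) (use that proj \<A> in
      \<open>auto simp: von_neumann_algebra_def inner_op_mult_left simp flip: diff_mult_right\<close>)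
  \<comment> \<open>An operator is viewed as a family of columns: \<open>Y j l\<close> maps column
    \<open>l\<close> of \<open>M\<close> to its contribution to column \<open>j\<close> of
    \<open>proj M\<close>. Commuting with left multiplication then means that each block
    commutes.\<close>
  define Y where "Y j l = (\<chi> i k. proj (matrix_unit k l) $ i $ j)" for j l
  have proj_Y: "proj M $ i $ j = (\<Sum>l\<in>UNIV. (Y j l ** M) $ i $ l)" for M i j
    unfolding clinear_expand[OF lin, of M]
    by (simp add: Y_def matrix_matrix_mult_def mult.commute) (rule sum.swap)
  have Y_col: "(Y j l ** M) $ i $ l' = proj (\<chi> a b. if b = l then M $ a $ l' else 0) $ i $ j" for M i j l l'
  proof -
    have "(Y j m ** (\<chi> a b. if b = l then M $ a $ l' else 0)) $ i $ m
        = (if m = l then (Y j l ** M) $ i $ l' else 0)" for m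
      by (simp add: matrix_matrix_mult_def)
    then show ?thesis unfolding proj_Y by simp
  qed
  have "Y j l \<in> commutant \<A>" for j l
    unfolding commutant_def
  proof (intro CollectI ballI)
    fix a assume a: "a \<in> \<A>"
    have "(Y j l ** a) $ i $ k = (a ** Y j l) $ i $ k" for i k
    proof -
      have "(\<chi> u b. if b = l then a $ u $ k else 0) = a ** matrix_unit k l"
        by (simp add: vec_eq_iff matrix_matrix_mult_def mult_delta_right)
      then have "(Y j l ** a) $ i $ k = proj (a ** matrix_unit k l) $ i $ j"
        by (simp add: Y_col)
      also have "\<dots> = (a ** Y j l) $ i $ k"
        by (simp add: proj_mult[OF a]) (simp add: matrix_matrix_mult_def Y_def)
      finally show ?thesis .
    qed
    then show "Y j l ** a = a ** Y j l" by (simp add: vec_eq_iff)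
  qed
  then have com: "Y j l ** X = X ** Y j l" for j l
    using X by (simp add: commutant_def)
  have "proj X = X ** proj (mat 1)"
  proof -
    have "proj X $ i $ j = (\<Sum>l\<in>UNIV. (X ** Y j l) $ i $ l)" for i j
      by (simp add: proj_Y com)
    also have "\<dots> i j = (X ** proj (mat 1)) $ i $ j" for i j
      by (simp add: matrix_matrix_mult_def[of X] proj_Y sum_distrib_left) (rule sum.swap)
    finally show ?thesis by (simp add: vec_eq_iff)
  qed
  moreover have "proj (mat 1) = mat 1"
    by (rule proj_eqI) (use \<A> in \<open>auto simp: von_neumann_algebra_def\<close>)
  ultimately show ?thesis using proj(1)[of X] by simp
qed

text \<open>The coefficients are real inner products, so an orthonormal basis over the reals
  qualifies. For a complex subspace its Casimir map is twice the one of a complex orthonormal basis,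
  a factor that the generalised inverse later absorbs.\<close>

definition casimir_basis :: "'m::finite operator set \<Rightarrow> 'm operator set \<Rightarrow> bool" where
  "casimir_basis S B \<longleftrightarrow> finite B \<and> B \<subseteq> S \<and> (\<forall>Y\<in>S. Y = (\<Sum>b\<in>B. (b \<bullet> Y) *\<^sub>R b))"

lemma casimir_basis_exists:
  fixes S :: "'m::finite operator set"
  assumes "subspace S"
  obtains B where "casimir_basis S B"
proof -
  obtain B where B: "B \<subseteq> S" "pairwise orthogonal B" "\<And>x. x \<in> B \<Longrightarrow> norm x = 1"
      "independent B" "span B = S"
    using orthonormal_basis_subspace[OF assms] by metis
  have fin: "finite B" using B(4) independent_imp_finite by blast
  have "Y = (\<Sum>b\<in>B. (b \<bullet> Y) *\<^sub>R b)" if "Y \<in> S" for Y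
  proof -
    define x where "x = Y - (\<Sum>b\<in>B. (b \<bullet> Y) *\<^sub>R b)"
    have "orthogonal x b" if b: "b \<in> B" for b
    proof -
      have "(\<Sum>c\<in>B. (c \<bullet> Y) * (c \<bullet> b)) = (\<Sum>c\<in>B. if c = b then b \<bullet> Y else 0)"
      proof (intro sum.cong refl)
        fix c assume c: "c \<in> B"
        show "(c \<bullet> Y) * (c \<bullet> b) = (if c = b then b \<bullet> Y else 0)"
        proof (cases "c = b")
          case True
          then show ?thesis using B(3)[OF b] by (simp flip: power2_norm_eq_inner)
        next
          case False
          then have "c \<bullet> b = 0" using B(2) b c by (auto simp: pairwise_def orthogonal_def)
          then show ?thesis using False by simp
        qed
      qed
      then have "(\<Sum>c\<in>B. (c \<bullet> Y) * (c \<bullet> b)) = Y \<bullet> b"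
        using fin b by (simp add: inner_commute)
      moreover have "x \<bullet> b = Y \<bullet> b - (\<Sum>c\<in>B. (c \<bullet> Y) * (c \<bullet> b))"
        unfolding x_def inner_diff_left inner_sum_left inner_scaleR_left ..
      ultimately show ?thesis by (simp add: orthogonal_def)
    qed
    moreover have "x \<in> span B"
      unfolding x_def by (intro span_diff span_sum span_scale) (use that B(5) in \<open>auto intro: span_base\<close>)
    ultimately have "orthogonal x x" using orthogonal_to_span by blast
    then show ?thesis by (simp add: orthogonal_self x_def)
  qed
  then show ?thesis using that fin B(1) by (auto simp: casimir_basis_def)
qed

text \<open>Left multiplication by \<open>Z\<close> acts on \<open>S\<close> with real coefficients
  \<open>c \<bullet> (Z ** b)\<close>, and \<open>adj Z\<close> has the transposed ones. Moving the
  coefficients from the left Kraus factor to the right one turns \<open>Z\<close> on the left into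
  \<open>Z\<close> on the right.\<close>

lemma casimir_commutes:
  fixes Z X :: "'m::finite operator"
  assumes B: "casimir_basis S B" and S: "\<And>Y. Y \<in> S \<Longrightarrow> Z ** Y \<in> S" "\<And>Y. Y \<in> S \<Longrightarrow> adj Z ** Y \<in> S"
  shows "Z ** kraus_map B id X = kraus_map B id X ** Z"
proof -
  have exp: "Y = (\<Sum>c\<in>B. (c \<bullet> Y) *\<^sub>R c)" if "Y \<in> S" for Y
    using B that by (auto simp: casimir_basis_def)
  have BS: "b \<in> S" if "b \<in> B" for b using B that by (auto simp: casimir_basis_def)
  have "Z ** kraus_map B id X = (\<Sum>b\<in>B. (Z ** b) ** X ** adj b)"
    by (simp add: kraus_map_def sum_mult_right matrix_mul_assoc)
  also have "\<dots> = (\<Sum>b\<in>B. \<Sum>c\<in>B. (c \<bullet> (Z ** b)) *\<^sub>R (c ** X ** adj b))"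
  proof (intro sum.cong refl)
    fix b assume "b \<in> B"
    then have "Z ** b = (\<Sum>c\<in>B. (c \<bullet> (Z ** b)) *\<^sub>R c)" using exp S(1) BS by blast
    then have "(Z ** b) ** X ** adj b = (\<Sum>c\<in>B. (c \<bullet> (Z ** b)) *\<^sub>R c) ** X ** adj b" by simp
    then show "(Z ** b) ** X ** adj b = (\<Sum>c\<in>B. (c \<bullet> (Z ** b)) *\<^sub>R (c ** X ** adj b))"
      by (simp only: sum_mult_left scaleR_mult_left)
  qed
  also have "\<dots> = (\<Sum>c\<in>B. \<Sum>b\<in>B. (b \<bullet> (adj Z ** c)) *\<^sub>R (c ** X ** adj b))"
  proof -
    have "c \<bullet> (Z ** b) = b \<bullet> (adj Z ** c)" for b c :: "'m operator"
      by (metis inner_commute inner_op_mult_left)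
    then show ?thesis by (subst sum.swap) simp
  qed
  also have "\<dots> = (\<Sum>c\<in>B. c ** X ** adj (adj Z ** c))"
  proof (intro sum.cong refl)
    fix c assume "c \<in> B"
    then have "adj Z ** c = (\<Sum>b\<in>B. (b \<bullet> (adj Z ** c)) *\<^sub>R b)" using exp S(2) BS by blast
    then have "c ** X ** adj (adj Z ** c) = c ** X ** adj (\<Sum>b\<in>B. (b \<bullet> (adj Z ** c)) *\<^sub>R b)" by simp
    then show "(\<Sum>b\<in>B. (b \<bullet> (adj Z ** c)) *\<^sub>R (c ** X ** adj b)) = c ** X ** adj (adj Z ** c)"
      by (simp only: sum_mult_right scaleR_mult_right adj_sum adj_scaleR)
  qed
  also have "\<dots> = kraus_map B id X ** Z"
    by (simp add: kraus_map_def sum_mult_left adj_mult matrix_mul_assoc)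
  finally show ?thesis .
qed

text \<open>\<open>adj\<close> is symmetric for the real inner product, so its coefficients can be
  moved between the two Kraus factors. The Casimir map is therefore its own adjoint with respect to
  the trace pairing.\<close>

lemma casimir_adj:
  fixes B :: "'m::finite operator set"
  assumes B: "casimir_basis S B" and S: "\<And>Y. Y \<in> S \<Longrightarrow> adj Y \<in> S"
  shows "kraus_map B id = kraus_map B adj"
proof
  fix X
  have exp: "Y = (\<Sum>c\<in>B. (c \<bullet> Y) *\<^sub>R c)" if "Y \<in> S" for Y
    using B that by (auto simp: casimir_basis_def)
  have BS: "b \<in> S" if "b \<in> B" for b using B that by (auto simp: casimir_basis_def)
  have "kraus_map B adj X = (\<Sum>b\<in>B. adj b ** X ** b)"
    by (simp add: kraus_map_def)
  also have "\<dots> = (\<Sum>b\<in>B. \<Sum>c\<in>B. (c \<bullet> adj b) *\<^sub>R (c ** X ** b))"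
  proof (intro sum.cong refl)
    fix b assume "b \<in> B"
    then have "adj b = (\<Sum>c\<in>B. (c \<bullet> adj b) *\<^sub>R c)" using exp S BS by blast
    then have "adj b ** X ** b = (\<Sum>c\<in>B. (c \<bullet> adj b) *\<^sub>R c) ** X ** b" by simp
    then show "adj b ** X ** b = (\<Sum>c\<in>B. (c \<bullet> adj b) *\<^sub>R (c ** X ** b))"
      by (simp only: sum_mult_left scaleR_mult_left)
  qed
  also have "\<dots> = (\<Sum>c\<in>B. \<Sum>b\<in>B. (b \<bullet> adj c) *\<^sub>R (c ** X ** b))"
  proof -
    have "c \<bullet> adj b = b \<bullet> adj c" for b c :: "'m operator"
      by (metis inner_commute inner_adj_left)
    then show ?thesis by (subst sum.swap) simp
  qed
  also have "\<dots> = (\<Sum>c\<in>B. c ** X ** adj c)"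
  proof (intro sum.cong refl)
    fix c assume "c \<in> B"
    then have "adj c = (\<Sum>b\<in>B. (b \<bullet> adj c) *\<^sub>R b)" using exp S BS by blast
    then have "c ** X ** adj c = c ** X ** (\<Sum>b\<in>B. (b \<bullet> adj c) *\<^sub>R b)" by simp
    then show "(\<Sum>b\<in>B. (b \<bullet> adj c) *\<^sub>R (c ** X ** b)) = c ** X ** adj c"
      by (simp only: sum_mult_right scaleR_mult_right)
  qed
  finally show "kraus_map B id X = kraus_map B adj X" by (simp add: kraus_map_def)
qed

text \<open>The component \<open>w\<close> of \<open>Q\<close> orthogonal to all \<open>Q\<^sup>2 Y\<close>, with \<open>Y\<close> in the double commutant of \<open>Q\<close>,
  satisfies \<open>\<parallel>Q w\<parallel>\<^sup>2 = w \<bullet> Q\<^sup>2 w = 0\<close>, hence \<open>w \<bullet> w = w \<bullet> Q = (Q w) \<bullet> mat 1 = 0\<close>. So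
  \<open>Q = Q\<^sup>2 R\<^sub>0\<close>, and \<open>R\<^sub>0\<^sup>* Q R\<^sub>0\<close> is a positive generalised inverse.\<close>
lemma positive_op_pseudo_inverse:
  fixes Q :: "'m::finite operator"
  assumes Q: "positive_op Q" "Q \<in> \<M>"
    and \<M>: "subspace \<M>" "\<And>A B. A \<in> \<M> \<Longrightarrow> B \<in> \<M> \<Longrightarrow> A ** B \<in> \<M>" "\<And>A. A \<in> \<M> \<Longrightarrow> adj A \<in> \<M>"
  obtains R where "R \<in> \<M>" "positive_op R" "\<And>Z. Z ** Q = Q ** Z \<Longrightarrow> Z ** R = R ** Z"
    "adj (R ** Q) = R ** Q" "R ** Q ** Q = Q" "R ** Q ** R ** Q = R ** Q"
proof -
  have Qa: "adj Q = Q" using Q by (simp add: positive_op_adj)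
  define \<Q> where "\<Q> = {Y\<in>\<M>. \<forall>Z. Z ** Q = Q ** Z \<longrightarrow> Z ** Y = Y ** Z}"
  have \<Q>: "subspace \<Q>"
    unfolding subspace_def \<Q>_def using \<M>(1)
    by (auto simp: subspace_0 subspace_add subspace_scale matrix_add_ldistrib matrix_add_rdistrib
        scaleR_mult_left scaleR_mult_right)
  define S where "S = (\<lambda>Y. Q ** Q ** Y) ` \<Q>"
  have S: "subspace S"
    unfolding S_def by (rule linear_subspace_image[OF _ \<Q>])
      (auto intro!: linearI simp: matrix_add_ldistrib scaleR_mult_right)
  have mult: "Q ** Y \<in> \<Q>" if "Y \<in> \<Q>" for Y
  proof -
    have "Z ** (Q ** Y) = Q ** Y ** Z" if "Z ** Q = Q ** Z" for Z
    proof -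
      have "Z ** Y = Y ** Z" using \<open>Y \<in> \<Q>\<close> that by (simp add: \<Q>_def)
      then show ?thesis using that by (metis matrix_mul_assoc)
    qed
    moreover have "Q ** Y \<in> \<M>" using that by (intro \<M>(2)[OF Q(2)]) (simp add: \<Q>_def)
    ultimately show ?thesis unfolding \<Q>_def by blast
  qed
  have QQ: "Q \<in> \<Q>" using Q by (auto simp: \<Q>_def)
  obtain u w where u: "u \<in> span S" and w: "\<And>x. x \<in> span S \<Longrightarrow> orthogonal w x" and uw: "Q = u + w"
    using orthogonal_subspace_decomp_exists[of S Q] by blast
  have span: "span S = S" using S by (simp add: span_eq_iff)
  obtain R0 where R0: "R0 \<in> \<Q>" "u = Q ** Q ** R0" using u unfolding span unfolding S_def by blast
  have "u \<in> \<Q>" using R0 mult by (simp flip: matrix_mul_assoc)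
  then have wQ: "w \<in> \<Q>" using uw QQ subspace_diff[OF \<Q> QQ, of u] by simp
  then have "Q ** Q ** w \<in> S" by (simp add: S_def)
  then have "w \<bullet> (Q ** Q ** w) = 0" using w span by (simp add: orthogonal_def)
  then have "(Q ** w) \<bullet> (Q ** w) = 0" by (simp add: inner_op_mult_left Qa matrix_mul_assoc)
  then have Qw: "Q ** w = 0" by simp
  have "w \<bullet> u = 0" using w u by (simp add: orthogonal_def)
  then have "w \<bullet> w = w \<bullet> Q" using uw by (simp add: inner_add_right)
  also have "\<dots> = (Q ** w) \<bullet> mat 1" by (simp add: inner_op_mult_left Qa)
  finally have "w = 0" using Qw by simp
  then have QR: "Q ** Q ** R0 = Q" using uw R0 by simp
  have com: "Z ** R0 = R0 ** Z" if "Z ** Q = Q ** Z" for Z using R0(1) that by (simp add: \<Q>_def)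
  have RQ: "R0 ** Q = Q ** R0" using com[of Q] by simp
  \<comment> \<open>This is the orthogonal projector onto the range of \<open>Q\<close>; the next
    steps show that it is self-adjoint and idempotent.\<close>
  define e where "e = Q ** R0"
  have Qe: "Q ** e = Q" using QR by (simp add: e_def matrix_mul_assoc)
  then have eaQ: "adj e ** Q = Q" using adj_mult[of Q e] Qa by simp
  then have "adj e ** e = e" by (simp add: e_def matrix_mul_assoc)
  then have ea: "adj e = e" by (metis adj_adj adj_mult)
  define R where "R = adj R0 ** Q ** R0"
  have RQe: "R ** Q = e"
  proof -
    have "R ** Q = adj R0 ** (Q ** Q ** R0)" by (simp add: R_def RQ flip: matrix_mul_assoc)
    also have "\<dots> = adj e" using QR Qa by (simp add: e_def adj_mult)
    finally show ?thesis by (simp add: ea)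
  qed
  have com': "Z ** adj R0 = adj R0 ** Z" if "Z ** Q = Q ** Z" for Z
  proof -
    have "adj (Z ** Q) = adj (Q ** Z)" using that by simp
    then have "adj Z ** Q = Q ** adj Z" by (simp add: adj_mult Qa)
    then have "adj (adj Z ** R0) = adj (R0 ** adj Z)" using com by simp
    then show ?thesis by (simp add: adj_mult)
  qed
  show ?thesis
  proof
    show "R \<in> \<M>" using R0(1) Q(2) \<M>(2,3) by (auto simp: R_def \<Q>_def)
    show "positive_op R" using positive_op_sandwich[OF Q(1), of "adj R0"] by (simp add: R_def)
    show "Z ** R = R ** Z" if "Z ** Q = Q ** Z" for Z
      unfolding R_def by (metis com com' matrix_mul_assoc that)
    show "adj (R ** Q) = R ** Q" by (simp add: RQe ea)
    show "R ** Q ** Q = Q" using eaQ ea by (simp add: RQe)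
    show "R ** Q ** R ** Q = R ** Q"
      using \<open>adj e ** e = e\<close> by (simp add: RQe ea flip: matrix_mul_assoc)
  qed
qed

section \<open>Operators on the symmetric subspace commuting with the gauge group\<close>

text \<open>The Cayley transform \<open>V = (1 + itH) (1 - itH)\<^sup>-\<^sup>1\<close>, characterised without inverses.\<close>
lemma cayley_transform:
  fixes H :: "'m::finite operator"
  assumes H: "adj H = H" "H \<in> commutant \<A>"
  obtains V where "V \<in> gauge_group \<A>" "V = mat 1 + (\<i> * of_real t) *\<^sub>M (H ** (mat 1 + V))"
proof -
  define c where "c = \<i> * complex_of_real t"
  define K where "K = mat 1 - c *\<^sub>M H"
  define L where "L = mat 1 + c *\<^sub>M H"
  have "cnj c = - c" by (simp add: c_def)
  then have adjK: "adj K = L" by (simp add: K_def L_def adj_diff adj_scale H(1))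
  then have adjL: "adj L = K" by (metis adj_adj)
  have KL: "K ** L = L ** K"
    by (simp add: K_def L_def diff_mult_left diff_mult_right matrix_add_ldistrib matrix_add_rdistrib)
  \<comment> \<open>\<open>cinner v (H *v v)\<close> is real and \<open>c\<close> is imaginary, so
    \<open>cinner v v\<close> would be both real and imaginary. Hence \<open>K\<close> is injective
    and thus invertible.\<close>
  have "v = 0" if "K *v v = 0" for v
  proof -
    have eq: "(c *\<^sub>M H) *v v = c *s (H *v v)"
      by (simp add: vec_eq_iff matrix_vector_mult_def sum_distrib_left mult.assoc)
    have "v = c *s (H *v v)" using that by (simp add: K_def matrix_vector_mult_diff_rdistrib eq)
    then have "cinner v v = c * cinner v (H *v v)" by (metis cinner_scale_right)
    moreover have "cnj (cinner v (H *v v)) = cinner v (H *v v)"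
      using H(1) by (simp add: cnj_cinner cinner_adj)
    then have "Im (cinner v (H *v v)) = 0" by (simp add: complex_eq_iff)
    ultimately have "Re (cinner v v) = 0" by (simp add: c_def)
    then show ?thesis by (simp add: Re_cinner)
  qed
  then obtain C where CK: "C ** K = mat 1" using matrix_left_invertible_ker by blast
  then have KC: "K ** C = mat 1" using matrix_left_right_inverse by blast
  have LD: "L ** adj C = mat 1" and DL: "adj C ** L = mat 1"
    using CK KC adjK by (metis adj_mat1 adj_mult)+
  have LC: "L ** C = C ** L"
  proof -
    have "C ** (K ** L) ** C = C ** (L ** K) ** C" by (simp add: KL)
    then show ?thesis using CK KC by (metis matrix_mul_assoc matrix_mul_lid matrix_mul_rid)
  qed
  define V where "V = L ** C"
  have adjV: "adj V = adj C ** K" by (simp add: V_def adj_mult adjL)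
  have "V ** adj V = C ** (L ** adj C) ** K" 
    by (simp only: adjV) (simp only: V_def LC matrix_mul_assoc)
  then have 1: "V ** adj V = mat 1" by (simp add: LD CK)
  have "adj V ** V = adj C ** (K ** L) ** C" 
    by (simp only: adjV) (simp only: V_def matrix_mul_assoc)
  also have "\<dots> = (adj C ** L) ** (K ** C)" by (simp add: KL matrix_mul_assoc)
  finally have 2: "adj V ** V = mat 1" by (simp add: DL KC)
  have LA: "L ** A = A ** L" "K ** A = A ** K" if "A \<in> \<A>" for A
    using H(2) that
    by (simp_all add: commutant_def L_def K_def matrix_add_ldistrib matrix_add_rdistrib
        diff_mult_left diff_mult_right scale_mat_mult_left scale_mat_mult_right)
  have "V ** A = A ** V" if A: "A \<in> \<A>" for A
  proof -
    have "C ** (K ** A) ** C = C ** (A ** K) ** C" by (simp add: LA[OF A])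
    then have "A ** C = C ** A" using CK KC by (metis matrix_mul_assoc matrix_mul_lid matrix_mul_rid)
    then show ?thesis using LA(1)[OF A] unfolding V_def by (metis matrix_mul_assoc)
  qed
  then have "V \<in> gauge_group \<A>" using 1 2 by (simp add: gauge_group_def unitary_def)
  moreover have "V = mat 1 + c *\<^sub>M (H ** (mat 1 + V))"
  proof -
    have cHC: "c *\<^sub>M (H ** C) = C - mat 1"
      using KC by (simp add: K_def diff_mult_left scale_mat_mult_left) (metis add_diff_cancel_left' diff_add_cancel)
    have "V = C + c *\<^sub>M (H ** C)" by (simp add: V_def L_def matrix_add_rdistrib scale_mat_mult_left)
    then have V: "V = C + C - mat 1" by (simp add: cHC)
    then have "mat 1 + V = C + C" by simp
    then have "c *\<^sub>M (H ** (mat 1 + V)) = (C - mat 1) + (C - mat 1)"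
      by (simp only: matrix_add_ldistrib mat_space.scale_right_distrib cHC)
    then show ?thesis using V by simp
  qed
  ultimately show ?thesis using that by (simp add: c_def)
qed

lemma unitary_entry_bound:
  assumes "unitary V" shows "cmod (V $ i $ j) \<le> 1"
proof -
  have "(V ** adj V) $ i $ i = (\<Sum>k\<in>UNIV. of_real ((cmod (V $ i $ k))\<^sup>2))"
    by (simp add: matrix_matrix_mult_def complex_norm_square del: of_real_power)
  moreover have "(V ** adj V) $ i $ i = 1"
    using assms by (simp add: unitary_def mat_def)
  ultimately have "complex_of_real (\<Sum>k\<in>UNIV. (cmod (V $ i $ k))\<^sup>2) = of_real 1" by simp
  then have "(\<Sum>k\<in>UNIV. (cmod (V $ i $ k))\<^sup>2) = 1" unfolding of_real_eq_iff .
  moreover have "(cmod (V $ i $ j))\<^sup>2 \<le> (\<Sum>k\<in>UNIV. (cmod (V $ i $ k))\<^sup>2)"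
    by (rule member_le_sum) auto
  ultimately show ?thesis using abs_square_le_1[of "cmod (V $ i $ j)"] by simp
qed

lemma tensor_upd_nth:
  "tensor (A(k := H)) $ f $ g = H $ f k $ g k * (\<Prod>j\<in>UNIV-{k}. A j $ f j $ g j)"
proof -
  have "tensor (A(k := H)) $ f $ g
      = (A(k := H)) k $ f k $ g k * (\<Prod>j\<in>UNIV-{k}. (A(k := H)) j $ f j $ g j)"
    unfolding tensor_nth by (rule prod.remove) auto
  also have "(\<Prod>j\<in>UNIV-{k}. (A(k := H)) j $ f j $ g j) = (\<Prod>j\<in>UNIV-{k}. A j $ f j $ g j)"
    by (intro prod.cong) auto
  finally show ?thesis by simp
qed

text \<open>The differential of \<open>tensor_power\<close> at the identity, that is, the action of
  \<open>H\<close> as a derivation on the tensor power.\<close>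

definition tensor_generator :: "'d::finite operator \<Rightarrow> ('n::finite \<Rightarrow> 'd) operator" where
  "tensor_generator H = (\<Sum>k\<in>UNIV. tensor ((\<lambda>_. mat 1)(k := H)))"

lemma tensor_generator_add:
  "tensor_generator (G + H) = tensor_generator G + tensor_generator H"
  by (simp add: tensor_generator_def vec_eq_iff tensor_upd_nth sum.distrib algebra_simps del: tensor_nth)

lemma tensor_generator_scale: "tensor_generator (c *\<^sub>M H) = c *\<^sub>M tensor_generator H"
  by (simp add: tensor_generator_def vec_eq_iff tensor_upd_nth sum_distrib_left mult.assoc del: tensor_nth)

text \<open>The commutation relation is differentiated at \<open>t = 0\<close> along the Cayley
  curve \<open>V t\<close>, which passes through the identity with velocity
  \<open>2 * \<i> * H\<close>.\<close>

lemma tensor_generator_commutes_self_adjoint: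
  fixes X :: "('n::finite \<Rightarrow> 'd::finite) operator"
  assumes X: "\<And>V. V \<in> gauge_group \<A> \<Longrightarrow> tensor_power V ** X = X ** tensor_power V"
    and H: "adj H = H" "H \<in> commutant \<A>"
  shows "tensor_generator H ** X = X ** tensor_generator H"
proof -
  have "\<exists>V. V \<in> gauge_group \<A> \<and> V = mat 1 + (\<i> * of_real t) *\<^sub>M (H ** (mat 1 + V))" for t
    using cayley_transform[OF H, of t] by blast
  then obtain V where V: "\<And>t. V t \<in> gauge_group \<A>"
    and eq: "\<And>t. V t = mat 1 + (\<i> * of_real t) *\<^sub>M (H ** (mat 1 + V t))" by metis
  have V0: "V 0 = mat 1" using eq[of 0] by (simp add: vec_eq_iff)
  have nth: "V t $ i $ j = (mat 1 :: 'd operator) $ i $ j + (\<i> * of_real t) * (H ** (mat 1 + V t)) $ i $ j" for t i j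
    by (subst eq) simp
  \<comment> \<open>The \<open>V t\<close> are chosen separately for each \<open>t\<close>, so no
    continuity is available at first. Entries of unitaries are bounded, and the factor
    \<open>t\<close> in \<open>eq\<close> then forces continuity at 0; inserting this limit into
    \<open>eq\<close> again gives the derivative.\<close>
  have bound: "cmod ((H ** (mat 1 + V t)) $ i $ j) \<le> (\<Sum>k\<in>UNIV. cmod (H $ i $ k) * 2)" for t i j
  proof -
    have "cmod ((mat 1 + V t) $ k $ j) \<le> 2" for k
    proof -
      have "cmod ((mat 1 :: 'd operator) $ k $ j) \<le> 1" by (simp add: mat_def)
      moreover have "cmod (V t $ k $ j) \<le> 1"
        using V by (simp add: gauge_group_def unitary_entry_bound)
      ultimately show ?thesis
        using norm_triangle_ineq[of "(mat 1 :: 'd operator) $ k $ j" "V t $ k $ j"] by simp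
    qed
    then show ?thesis
      unfolding matrix_matrix_mult_def
      by (auto simp: norm_mult intro!: order_trans[OF norm_sum] sum_mono mult_left_mono)
  qed
  have lim: "((\<lambda>t. V t $ i $ j) \<longlongrightarrow> (mat 1 :: 'd operator) $ i $ j) (at 0)" for i j
  proof -
    have "((\<lambda>t. (\<i> * of_real t) * (H ** (mat 1 + V t)) $ i $ j) \<longlongrightarrow> 0) (at (0::real))"
    proof (rule Lim_null_comparison)
      show "\<forall>\<^sub>F t in at (0::real). norm ((\<i> * of_real t) * (H ** (mat 1 + V t)) $ i $ j)
          \<le> \<bar>t\<bar> * (\<Sum>k\<in>UNIV. cmod (H $ i $ k) * 2)"
        using bound by (intro always_eventually allI) (simp add: norm_mult mult_left_mono)
      show "((\<lambda>t. \<bar>t\<bar> * (\<Sum>k\<in>UNIV. cmod (H $ i $ k) * 2)) \<longlongrightarrow> 0) (at (0::real))"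
        by (auto intro!: tendsto_eq_intros)
    qed
    from tendsto_add[OF tendsto_const this, of "(mat 1 :: 'd operator) $ i $ j"]
    show ?thesis by (simp flip: nth)
  qed
  have lim2: "((\<lambda>t. \<i> * (H ** (mat 1 + V t)) $ i $ j) \<longlongrightarrow> 2 * \<i> * H $ i $ j) (at 0)" for i j
  proof -
    have "((\<lambda>t. \<i> * (H ** (mat 1 + V t)) $ i $ j) \<longlongrightarrow> \<i> * (H ** (mat 1 + mat 1)) $ i $ j) (at 0)"
      unfolding matrix_matrix_mult_def vec_lambda_beta vector_add_component
      by (intro tendsto_intros lim)
    moreover have "\<i> * (H ** (mat 1 + mat 1)) $ i $ j = 2 * \<i> * H $ i $ j"
      by (simp only: matrix_add_ldistrib matrix_mul_rid vector_add_component) simp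
    ultimately show ?thesis by (simp only:)
  qed
  have der: "((\<lambda>t. V t $ i $ j) has_vector_derivative 2 * \<i> * H $ i $ j) (at 0)" for i j
  proof -
    define d where "d = 2 * \<i> * H $ i $ j"
    have "((\<lambda>t. norm (\<i> * (H ** (mat 1 + V t)) $ i $ j - d)) \<longlongrightarrow> norm (d - d)) (at (0::real))"
      unfolding d_def by (intro tendsto_intros lim2)
    then have "((\<lambda>t. norm (\<i> * (H ** (mat 1 + V t)) $ i $ j - d)) \<longlongrightarrow> 0) (at (0::real))" by simp
    then have "((\<lambda>t. norm (V (0 + t) $ i $ j - V 0 $ i $ j - t *\<^sub>R d) / norm t) \<longlongrightarrow> 0) (at 0)"
    proof (rule Lim_transform_eventually)
      have "norm (\<i> * (H ** (mat 1 + V t)) $ i $ j - d)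
          = norm (V (0 + t) $ i $ j - V 0 $ i $ j - t *\<^sub>R d) / norm t" if "t \<noteq> 0" for t
      proof -
        have "V (0 + t) $ i $ j - V 0 $ i $ j - t *\<^sub>R d
            = of_real t * (\<i> * (H ** (mat 1 + V t)) $ i $ j - d)"
          using nth[of t i j] by (simp add: V0 scaleR_conv_of_real algebra_simps)
        then show ?thesis using that by (simp only: norm_mult norm_of_real real_norm_def) simp
      qed
      then show "\<forall>\<^sub>F t in at 0. norm (\<i> * (H ** (mat 1 + V t)) $ i $ j - d)
          = norm (V (0 + t) $ i $ j - V 0 $ i $ j - t *\<^sub>R d) / norm t"
        by (auto simp: eventually_at_filter)
    qed
    then show ?thesis
      unfolding has_vector_derivative_def has_derivative_at d_def
      by (simp add: bounded_linear_scaleR_left)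
  qed
  have derT: "((\<lambda>t. tensor_power (V t) $ f $ g) has_vector_derivative
      2 * \<i> * tensor_generator H $ f $ g) (at 0)" for f g :: "'n \<Rightarrow> 'd"
  proof -
    have "((\<lambda>t. \<Prod>k\<in>UNIV. V t $ f k $ g k) has_derivative
        (\<lambda>y. \<Sum>k\<in>UNIV. y *\<^sub>R (2 * \<i> * H $ f k $ g k) * (\<Prod>j\<in>UNIV - {k}. V 0 $ f j $ g j))) (at 0)"
      by (rule has_derivative_prod) (use der in \<open>simp add: has_vector_derivative_def\<close>)
    then show ?thesis
      unfolding has_vector_derivative_def tensor_power_def tensor_generator_def
      by (simp add: V0 tensor_upd_nth sum_distrib_left scaleR_sum_right mult.assoc flip: tensor_nth)
  qed
  have "(tensor_generator H ** X) $ f $ g = (X ** tensor_generator H) $ f $ g" for f g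
  proof -
    have 1: "((\<lambda>t. \<Sum>h\<in>UNIV. tensor_power (V t) $ f $ h * X $ h $ g) has_vector_derivative
        (\<Sum>h\<in>UNIV. 2 * \<i> * tensor_generator H $ f $ h * X $ h $ g)) (at 0)"
      by (intro has_vector_derivative_sum has_vector_derivative_mult_left derT)
    have 2: "((\<lambda>t. \<Sum>h\<in>UNIV. X $ f $ h * tensor_power (V t) $ h $ g) has_vector_derivative
        (\<Sum>h\<in>UNIV. X $ f $ h * (2 * \<i> * tensor_generator H $ h $ g))) (at 0)"
      by (intro has_vector_derivative_sum has_vector_derivative_mult_right derT)
    have "(\<Sum>h\<in>UNIV. tensor_power (V t) $ f $ h * X $ h $ g)
        = (\<Sum>h\<in>UNIV. X $ f $ h * tensor_power (V t) $ h $ g)" for t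
      using X[OF V, of t] by (simp add: vec_eq_iff matrix_matrix_mult_def)
    then have "(\<Sum>h\<in>UNIV. 2 * \<i> * tensor_generator H $ f $ h * X $ h $ g)
        = (\<Sum>h\<in>UNIV. X $ f $ h * (2 * \<i> * tensor_generator H $ h $ g))"
      using vector_derivative_unique_at[OF 1] 2 by simp
    moreover have "\<dots> = 2 * \<i> * (X ** tensor_generator H) $ f $ g"
      by (simp add: matrix_matrix_mult_def sum_distrib_left mult_ac)
    moreover have "(\<Sum>h\<in>UNIV. 2 * \<i> * tensor_generator H $ f $ h * X $ h $ g)
        = 2 * \<i> * (tensor_generator H ** X) $ f $ g"
      by (simp add: matrix_matrix_mult_def sum_distrib_left mult_ac)
    ultimately show ?thesis by simp
  qed
  then show ?thesis by (simp add: vec_eq_iff)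
qed

text \<open>Unitaries only supply self-adjoint generators; complex linearity of
  \<open>tensor_generator\<close> extends the relation through real and imaginary parts.\<close>

lemma tensor_generator_commutes:
  fixes X :: "('n::finite \<Rightarrow> 'd::finite) operator"
  assumes \<A>: "von_neumann_algebra \<A>"
    and X: "\<And>V. V \<in> gauge_group \<A> \<Longrightarrow> tensor_power V ** X = X ** tensor_power V"
    and H: "H \<in> commutant \<A>"
  shows "tensor_generator H ** X = X ** tensor_generator H"
proof -
  define G where "G = H + adj H"
  define K where "K = \<i> *\<^sub>M (H - adj H)"
  have "G \<in> commutant \<A>" "K \<in> commutant \<A>"
    using H commutant_adj[OF \<A> H] by (simp_all add: G_def K_def commutant_add commutant_scale commutant_diff)
  moreover have "adj G = G" "adj K = K"
    by (simp_all add: G_def K_def adj_add adj_scale adj_diff vec_eq_iff algebra_simps)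
  ultimately have com: "tensor_generator G ** X = X ** tensor_generator G"
      "tensor_generator K ** X = X ** tensor_generator K"
    using tensor_generator_commutes_self_adjoint[OF X] by blast+
  have "H = (1/2) *\<^sub>M G + (- \<i> / 2) *\<^sub>M K"
    by (simp add: G_def K_def vec_eq_iff algebra_simps)
  then have "(tensor_generator H :: ('n \<Rightarrow> 'd) operator)
      = (1/2) *\<^sub>M tensor_generator G + (- \<i> / 2) *\<^sub>M tensor_generator K"
    by (simp only: tensor_generator_add tensor_generator_scale)
  then show ?thesis
    using com by (simp only: matrix_add_ldistrib matrix_add_rdistrib scale_mat_mult_left scale_mat_mult_right)
qed

lemma perm_op_tensor_generator:
  assumes "\<sigma> permutes (UNIV :: 'n::finite set)"
  shows "perm_op \<sigma> ** tensor_generator H = tensor_generator H ** perm_op \<sigma>"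
proof -
  have inj: "\<sigma> i = k \<longleftrightarrow> i = inv \<sigma> k" for i k
    using permutes_inverses[OF assms] by metis
  have "((\<lambda>_. mat 1)(k := H)) \<circ> \<sigma> = (\<lambda>_. mat 1)(inv \<sigma> k := H)" for k
    by (auto simp: fun_eq_iff inj)
  then have "perm_op \<sigma> ** tensor_generator H = (\<Sum>k\<in>UNIV. tensor ((\<lambda>_. mat 1)(inv \<sigma> k := H))) ** perm_op \<sigma>"
    by (simp add: tensor_generator_def sum_mult_left sum_mult_right perm_op_tensor[OF assms])
  also have "(\<Sum>k\<in>UNIV. tensor ((\<lambda>_. mat 1)(inv \<sigma> k := H))) = tensor_generator H"
    using sum.permute[OF permutes_inv[OF assms], of "\<lambda>k. tensor ((\<lambda>_. mat 1)(k := H))"]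
    by (simp add: tensor_generator_def comp_def)
  finally show ?thesis .
qed

text \<open>Induction on the number of factors different from the identity: multiplying by the
  \<^term>\<open>tensor_generator\<close> of a new factor puts it into all positions. Positions that are occupied
  already are covered by the induction hypothesis, and the others are equivalent by symmetry.\<close>
lemma sym_proj_tensor_commute_aux:
  fixes X :: "('n::finite \<Rightarrow> 'd::finite) operator"
  assumes sym: "sym_proj ** X = X" "X ** sym_proj = X"
    and gen: "\<And>H. H \<in> commutant \<A> \<Longrightarrow> tensor_generator H ** X = X ** tensor_generator H"
    and "finite S" "\<And>k. Y k \<in> commutant \<A>" "\<And>k. k \<notin> S \<Longrightarrow> Y k = mat 1"
  shows "sym_proj ** tensor Y ** X = X ** tensor Y ** sym_proj"
  using assms(4-)
proof (induction S arbitrary: Y rule: finite_induct)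
  case empty
  then have "Y = (\<lambda>_. mat 1)" by auto
  then show ?case using sym by simp
next
  case (insert j S)
  define Y0 where "Y0 = Y(j := mat 1)"
  define H where "H = Y j"
  define D where "D = (tensor_generator H :: ('n \<Rightarrow> 'd) operator)"
  define T where "T k = Y0(k := Y0 k ** H)" for k
  define g where "g k = sym_proj ** tensor (T k) ** X - X ** tensor (T k) ** sym_proj" for k
  have H: "H \<in> commutant \<A>" using insert.prems by (simp add: H_def)
  have Y0: "Y0 k \<in> commutant \<A>" for k using insert.prems by (simp add: Y0_def commutant_mat1)
  have Y0_1: "Y0 k = mat 1" if "k \<notin> S" for k using that insert.prems by (auto simp: Y0_def)
  have IH0: "sym_proj ** tensor Y0 ** X = X ** tensor Y0 ** sym_proj"
    using insert.IH Y0 Y0_1 by blast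
  have TD: "tensor Y0 ** D = (\<Sum>k\<in>UNIV. tensor (T k))"
  proof -
    have "(\<lambda>i. Y0 i ** ((\<lambda>_. mat 1)(k := H)) i) = T k" for k
      by (auto simp: T_def fun_eq_iff)
    then show ?thesis
      by (simp add: D_def tensor_generator_def sum_mult_right tensor_mult)
  qed
  have DX: "D ** X = X ** D" using gen[OF H] by (simp add: D_def)
  have DP: "sym_proj ** D = D ** sym_proj"
    unfolding D_def by (rule commute_sym_projI) (rule perm_op_tensor_generator)
  \<comment> \<open>\<open>D\<close> commutes with \<open>X\<close> and with the projector, so it
    can be carried through the induction hypothesis from one side to the other.\<close>
  have "sym_proj ** (tensor Y0 ** D) ** X = (sym_proj ** tensor Y0 ** X) ** D"
    by (simp add: DX flip: matrix_mul_assoc)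
  also have "\<dots> = X ** tensor Y0 ** (sym_proj ** D)"
    by (simp only: IH0 matrix_mul_assoc)
  also have "\<dots> = X ** (tensor Y0 ** D) ** sym_proj"
    by (simp only: DP matrix_mul_assoc)
  finally have "sym_proj ** (tensor Y0 ** D) ** X = X ** (tensor Y0 ** D) ** sym_proj" .
  then have sum0: "(\<Sum>k\<in>UNIV. g k) = 0"
    unfolding TD g_def by (simp add: sum_mult_left sum_mult_right sum_subtractf)
  have gS: "g k = 0" if "k \<in> S" for k
  proof -
    have "sym_proj ** tensor (T k) ** X = X ** tensor (T k) ** sym_proj"
      by (rule insert.IH) (use Y0 Y0_1 H that in \<open>auto simp: T_def commutant_mult\<close>)
    then show ?thesis by (simp add: g_def)
  qed
  have gj: "g k = g j" if k: "k \<notin> S" for k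
  proof -
    define \<sigma> where "\<sigma> = Transposition.transpose j k"
    have \<sigma>: "\<sigma> permutes UNIV" by (simp add: \<sigma>_def permutes_swap_id)
    have "T k = T j \<circ> \<sigma>"
      using Y0_1[OF k] Y0_1[OF \<open>j \<notin> S\<close>]
      by (auto simp: T_def \<sigma>_def fun_eq_iff Transposition.transpose_def)
    then have com: "perm_op \<sigma> ** tensor (T j) = tensor (T k) ** perm_op \<sigma>"
      using perm_op_tensor[OF \<sigma>] by metis
    have XP: "perm_op \<sigma> ** X = X" "X ** perm_op \<sigma> = X"
      using perm_op_sym_proj[OF \<sigma>] sym by (metis matrix_mul_assoc)+
    have "sym_proj ** tensor (T k) ** X = sym_proj ** (tensor (T k) ** perm_op \<sigma>) ** X"
      by (simp add: XP flip: matrix_mul_assoc)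
    also have "\<dots> = sym_proj ** tensor (T j) ** X"
      by (simp add: com[symmetric] matrix_mul_assoc perm_op_sym_proj[OF \<sigma>])
    finally have 1: "sym_proj ** tensor (T k) ** X = sym_proj ** tensor (T j) ** X" .
    have "X ** tensor (T k) ** sym_proj = X ** (tensor (T k) ** perm_op \<sigma>) ** sym_proj"
      by (simp add: perm_op_sym_proj[OF \<sigma>] flip: matrix_mul_assoc)
    also have "\<dots> = X ** tensor (T j) ** sym_proj"
      by (simp add: com[symmetric] matrix_mul_assoc XP)
    finally show ?thesis using 1 by (simp add: g_def)
  qed
  have "(\<Sum>k\<in>UNIV. g k) = (\<Sum>k\<in>-S. g k)"
    by (rule sum.mono_neutral_right) (auto simp: gS)
  also have "\<dots> = (\<Sum>k\<in>-S. g j)" by (intro sum.cong) (auto simp: gj)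
  also have "\<dots> = of_nat (card (-S)) *\<^sub>R g j" by (rule sum_constant_scaleR)
  finally have "of_nat (card (-S)) *\<^sub>R g j = 0" using sum0 by simp
  moreover have "card (-S) \<noteq> 0" using insert.hyps by (auto simp: card_eq_0_iff)
  ultimately have "g j = 0" by simp
  moreover have "T j = Y" by (auto simp: T_def Y0_def H_def fun_eq_iff)
  ultimately show ?case by (simp add: g_def)
qed

text \<open>The bridge from diagonal to independent symmetry: on the symmetric subspace, invariance
  under equal gauge transformations of all factors controls arbitrary products of commutant
  elements, at the cost of a projector on the far side.\<close>

lemma sym_proj_tensor_commute:
  fixes X :: "('n::finite \<Rightarrow> 'd::finite) operator"
  assumes "von_neumann_algebra \<A>" "sym_proj ** X = X" "X ** sym_proj = X"
    and "\<And>V. V \<in> gauge_group \<A> \<Longrightarrow> tensor_power V ** X = X ** tensor_power V"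
    and "\<And>k. Y k \<in> commutant \<A>"
  shows "sym_proj ** tensor Y ** X = X ** tensor Y ** sym_proj"
  by (rule sym_proj_tensor_commute_aux[OF assms(2,3) tensor_generator_commutes[OF assms(1,4)],
        where S=UNIV]) (use assms(5) in auto)

section \<open>Reduction to the tensor power of the algebra\<close>

lemma tensor_commutant_commutes:
  assumes "a \<in> algebra_tensor_power \<A>" "\<And>k. Y k \<in> commutant \<A>"
  shows "tensor Y ** a = a ** tensor Y"
  using assms(1)
proof (induction rule: algebra_tensor_power_induct)
  case zero
  then show ?case by (simp add: vec_eq_iff matrix_matrix_mult_def)
next
  case (add x y)
  then show ?case by (simp add: matrix_add_ldistrib matrix_add_rdistrib)
next
  case (scale c x)
  then show ?case by (simp add: scale_mat_mult_left scale_mat_mult_right)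
next
  case (tensor A)
  then show ?case using assms(2) by (simp add: tensor_mult commutant_def)
qed

lemma tensor_scaleR: "tensor (\<lambda>k. r k *\<^sub>R A k) = (\<Prod>k\<in>UNIV. r k) *\<^sub>R tensor A"
  by (simp add: vec_eq_iff) (simp add: scaleR_conv_of_real prod.distrib)

text \<open>One-factor Casimir values commute with the whole commutant, hence lie in \<A> by the
  double commutant theorem; expansion in product matrix units lifts this to all factors.\<close>

lemma casimir_tensor_in_algebra:
  assumes \<A>: "von_neumann_algebra \<A>" and B: "casimir_basis (commutant \<A>) B"
  shows "tensor_kraus_map B id X \<in> algebra_tensor_power \<A>"
proof -
  have "kraus_map B id Z \<in> \<A>" for Z
  proof (rule double_commutant[OF \<A>])
    show "kraus_map B id Z \<in> commutant (commutant \<A>)"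
      unfolding commutant_def[of "commutant \<A>"]
      using commutant_mult commutant_adj[OF \<A>]
      by (auto intro!: sym[OF casimir_commutes[OF B]])
  qed
  moreover have "finite B" using B by (simp add: casimir_basis_def)
  ultimately show ?thesis
    by (simp add: tensor_kraus_map_expand algebra_tensor_power_sum algebra_tensor_power_scale
        tensor_in_algebra)
qed

lemma casimir_tensor_adj:
  assumes \<A>: "von_neumann_algebra \<A>" and B: "casimir_basis (commutant \<A>) B"
  shows "tensor_kraus_map B id = tensor_kraus_map B adj"
proof -
  have "finite B" using B by (simp add: casimir_basis_def)
  then show ?thesis
    using casimir_adj[OF B commutant_adj[OF \<A>]] by (simp add: fun_eq_iff tensor_kraus_map_expand)
qed

text \<open>All factors use the same Kraus family, so a permutation only reindexes the choices
  \<open>h\<close>.\<close>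

lemma perm_op_tensor_kraus_map:
  assumes \<sigma>: "\<sigma> permutes (UNIV :: 'n::finite set)" and X: "perm_op \<sigma> ** X = X ** perm_op \<sigma>"
  shows "perm_op \<sigma> ** tensor_kraus_map B K X = tensor_kraus_map B K X ** perm_op \<sigma>"
proof -
  let ?T = "\<lambda>h. tensor (\<lambda>k. K (h k)) ** X ** adj (tensor (\<lambda>k. K (h k)))"
  have "perm_op \<sigma> ** ?T h = ?T (h \<circ> \<sigma>) ** perm_op \<sigma>" for h
  proof -
    have 1: "perm_op \<sigma> ** tensor (\<lambda>k. K (h k)) = tensor (\<lambda>k. K ((h \<circ> \<sigma>) k)) ** perm_op \<sigma>"
      using perm_op_tensor[OF \<sigma>, of "\<lambda>k. K (h k)"] by (simp add: comp_def)
    have 2: "perm_op \<sigma> ** adj (tensor (\<lambda>k. K (h k))) = adj (tensor (\<lambda>k. K ((h \<circ> \<sigma>) k))) ** perm_op \<sigma>"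
      using perm_op_tensor[OF \<sigma>, of "\<lambda>k. adj (K (h k))"] by (simp add: comp_def adj_tensor)
    have "perm_op \<sigma> ** ?T h = (perm_op \<sigma> ** tensor (\<lambda>k. K (h k))) ** X ** adj (tensor (\<lambda>k. K (h k)))"
      by (simp only: matrix_mul_assoc)
    also have "\<dots> = tensor (\<lambda>k. K ((h \<circ> \<sigma>) k)) ** (perm_op \<sigma> ** X) ** adj (tensor (\<lambda>k. K (h k)))"
      by (simp only: 1 matrix_mul_assoc)
    also have "\<dots> = tensor (\<lambda>k. K ((h \<circ> \<sigma>) k)) ** X ** (perm_op \<sigma> ** adj (tensor (\<lambda>k. K (h k))))"
      by (simp only: X matrix_mul_assoc)
    also have "\<dots> = ?T (h \<circ> \<sigma>) ** perm_op \<sigma>"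
      by (simp only: 2 matrix_mul_assoc)
    finally show ?thesis .
  qed
  then have "perm_op \<sigma> ** tensor_kraus_map B K X
      = (\<Sum>h\<in>UNIV \<rightarrow>\<^sub>E B. ?T (h \<circ> \<sigma>)) ** perm_op \<sigma>"
    by (simp add: tensor_kraus_map_def kraus_map_def sum_mult_left sum_mult_right)
  also have "(\<Sum>h\<in>UNIV \<rightarrow>\<^sub>E B. ?T (h \<circ> \<sigma>)) = (\<Sum>h\<in>UNIV \<rightarrow>\<^sub>E B. ?T h)"
    by (rule sum.reindex_bij_witness[of _ "\<lambda>h. h \<circ> inv \<sigma>" "\<lambda>h. h \<circ> \<sigma>"])
      (auto simp: comp_assoc permutes_inv_o[OF \<sigma>] PiE_iff)
  finally show ?thesis by (simp add: tensor_kraus_map_def kraus_map_def)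
qed

text \<open>Let \<open>\<Theta>\<close> be the symmetric projector. With \<open>F\<close> the Casimir map of the commutant, \<open>F X\<close> replaces the twirl over independent gauge
  transformations of the factors. For \<open>X\<close> on the symmetric subspace that commutes with the
  diagonal gauge action, the lemma \<open>sym_proj_tensor_commute\<close> gives \<open>\<Theta> F(X) \<Theta> = X Q \<Theta>\<close> with
  \<open>Q = F(\<Theta>)\<close>, so \<open>X\<close> is recovered by the generalised inverse \<open>R\<close> of \<open>Q\<close>. The map below is the
  adjoint of this recovery, completed to a unital map.\<close>
lemma reduction_map:
  fixes \<A> :: "'d::finite operator set"
  assumes \<A>: "von_neumann_algebra \<A>"
  obtains L :: "('n::finite \<Rightarrow> 'd) operator \<Rightarrow> ('n \<Rightarrow> 'd) operator"
  where "clinear L" "\<And>W. positive_op W \<Longrightarrow> positive_op (L W)" "L (mat 1) = mat 1"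
    "\<And>W. L W \<in> algebra_tensor_power \<A>"
    "\<And>W X. sym_proj ** X = X \<Longrightarrow> X ** sym_proj = X \<Longrightarrow>
      (\<And>V. V \<in> gauge_group \<A> \<Longrightarrow> tensor_power V ** X = X ** tensor_power V) \<Longrightarrow>
      trace (L W ** X) = trace (W ** X)"
proof -
  obtain B where B: "casimir_basis (commutant \<A>) B"
    using casimir_basis_exists[OF commutant_subspace] .
  have finB: "finite B" and BA: "B \<subseteq> commutant \<A>" using B by (auto simp: casimir_basis_def)
  define I where "I = (UNIV :: 'n set) \<rightarrow>\<^sub>E B"
  define T where "T h = (tensor h :: ('n \<Rightarrow> 'd) operator)" for h
  define \<Theta> where "\<Theta> = (sym_proj :: ('n \<Rightarrow> 'd) operator)"
  define F where "F = (tensor_kraus_map B id :: ('n \<Rightarrow> 'd) operator \<Rightarrow> _)"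
  define \<M> where "\<M> = (algebra_tensor_power \<A> :: ('n \<Rightarrow> 'd) operator set)"
  have F: "F X = (\<Sum>h\<in>I. T h ** X ** adj (T h))" for X
    by (simp add: F_def tensor_kraus_map_def kraus_map_def I_def T_def)
  have F': "F X = (\<Sum>h\<in>I. adj (T h) ** X ** T h)" for X
    unfolding F_def casimir_tensor_adj[OF \<A> B]
    by (simp add: tensor_kraus_map_def kraus_map_def I_def T_def adj_tensor)
  have hB: "h k \<in> commutant \<A>" if "h \<in> I" for h k using that BA by (auto simp: I_def)
  have FM: "F X \<in> \<M>" for X unfolding F_def \<M>_def by (rule casimir_tensor_in_algebra[OF \<A> B])
  have TM: "T h ** a = a ** T h" if "h \<in> I" "a \<in> \<M>" for h a
    using that hB unfolding T_def \<M>_def by (intro tensor_commutant_commutes) auto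
  have TM': "adj (T h) ** a = a ** adj (T h)" if "h \<in> I" "a \<in> \<M>" for h a
    using that hB commutant_adj[OF \<A>] unfolding T_def \<M>_def adj_tensor
    by (intro tensor_commutant_commutes) auto
  have F_left: "F (a ** X) = a ** F X" if "a \<in> \<M>" for a X
    unfolding F sum_mult_right using TM[OF _ that] by (intro sum.cong) (simp_all add: matrix_mul_assoc)
  have F_right: "F (X ** a) = F X ** a" if "a \<in> \<M>" for a X
    unfolding F sum_mult_left using TM'[OF _ that]
    by (intro sum.cong) (simp_all flip: matrix_mul_assoc)
  have F_pos: "positive_op (F X)" if "positive_op X" for X
    using that by (simp add: F_def tensor_kraus_map_def positive_kraus_map)
  have \<Theta>: "\<Theta> ** \<Theta> = \<Theta>" "adj \<Theta> = \<Theta>" by (simp_all add: \<Theta>_def sym_proj_idem adj_sym_proj)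
  have \<Theta>pos: "positive_op (\<Theta> ** W ** \<Theta>)" if "positive_op W" for W
    using positive_op_sandwich[OF that, of \<Theta>] by (simp add: \<Theta>)
  have \<Theta>_F: "\<Theta> ** F (\<Theta> ** W ** \<Theta>) = F (\<Theta> ** W ** \<Theta>) ** \<Theta>" for W
    unfolding \<Theta>_def F_def
    by (rule commute_sym_projI, rule perm_op_tensor_kraus_map)
      (simp_all add: perm_op_sym_proj matrix_mul_assoc, simp add: perm_op_sym_proj flip: matrix_mul_assoc)
  define Q where "Q = F \<Theta>"
  \<comment> \<open>This order of adjoints is the one that the trace identity at the end produces,
    and self-adjointness of the Casimir map makes it equal to \<open>F \<Theta>\<close>.\<close>
  have Q_adj: "Q = (\<Sum>h\<in>I. adj (T h) ** \<Theta> ** T h)" by (simp only: Q_def F')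
  have QM: "Q \<in> \<M>" by (simp add: Q_def FM)
  have "positive_op (\<Theta> ** mat 1 ** \<Theta>)"
    using positive_op_sandwich[of "mat 1" "mat 1"] by (intro \<Theta>pos) (simp add: positive_op_iff)
  then have "positive_op Q" using F_pos \<Theta> by (simp add: Q_def)
  moreover have "subspace \<M>"
    unfolding \<M>_def subspace_def
    using mat_space.subspace_0[OF subspace_algebra_tensor_power, of \<A>]
    by (simp add: algebra_tensor_power_add algebra_tensor_power_scaleR)
  moreover have \<M>_mult: "a ** b \<in> \<M>" if "a \<in> \<M>" "b \<in> \<M>" for a b
    using that unfolding \<M>_def by (rule algebra_tensor_power_mult[OF \<A>])
  ultimately obtain R where R: "R \<in> \<M>" "positive_op R" "\<And>Z. Z ** Q = Q ** Z \<Longrightarrow> Z ** R = R ** Z"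
      "adj (R ** Q) = R ** Q" "R ** Q ** Q = Q" "R ** Q ** R ** Q = R ** Q"
    using positive_op_pseudo_inverse[of Q \<M>] QM algebra_tensor_power_adj[OF \<A>]
    unfolding \<M>_def by metis
  \<comment> \<open>The projector onto the kernel of \<open>Q\<close>, where dividing by
    \<open>Q\<close> recovers nothing.\<close>
  define P where "P = mat 1 - R ** Q"
  have P_adj: "adj P = P" using R(4) by (simp add: P_def adj_diff)
  have PQ: "P ** Q = 0" using R(5) by (simp add: P_def diff_mult_left)
  have PP: "P ** P = P" using R(6) by (simp add: P_def diff_mult_left diff_mult_right matrix_mul_assoc)
  have P_pos: "positive_op P"
    using positive_op_sandwich[of "mat 1" P] by (simp add: P_adj PP positive_op_iff)
  have PM: "P \<in> \<M>"
    unfolding P_def \<M>_def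
    by (intro algebra_tensor_power_diff algebra_tensor_power_1[OF \<A>])
      (use \<M>_mult[OF R(1) QM] in \<open>simp add: \<M>_def\<close>)
  \<comment> \<open>\<open>P ** Q ** P = 0\<close> is a sum of positive terms
    \<open>adj (M h) ** M h\<close>; by the Hilbert-Schmidt norm each of them vanishes.\<close>
  have PT\<Theta>: "P ** T h ** \<Theta> = 0" if h: "h \<in> I" for h
  proof -
    define M where "M h = \<Theta> ** adj (T h) ** P" for h
    have "P ** (T h ** \<Theta> ** adj (T h)) ** P = adj (M h) ** M h" for h
    proof -
      have "adj (M h) ** M h = P ** T h ** (\<Theta> ** \<Theta>) ** adj (T h) ** P"
        unfolding M_def adj_mult adj_adj \<Theta>(2) P_adj by (simp only: matrix_mul_assoc)
      then show ?thesis by (simp only: \<Theta>(1) matrix_mul_assoc)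
    qed
    then have "(\<Sum>h\<in>I. adj (M h) ** M h) = P ** Q ** P"
      by (simp add: Q_def F sum_mult_left sum_mult_right)
    then have "(\<Sum>h\<in>I. adj (M h) ** M h) = 0"
      by (simp add: PQ)
    then have "Re (trace (\<Sum>h\<in>I. adj (M h) ** M h)) = 0" by (simp add: trace_def)
    then have "(\<Sum>h\<in>I. M h \<bullet> M h) = 0" by (simp add: inner_op trace_sum)
    moreover have "finite I" using finB by (auto simp: I_def intro: finite_PiE)
    ultimately have "M h \<bullet> M h = 0" using h by (simp add: sum_nonneg_eq_0_iff)
    then have "adj (M h) = 0" by (simp add: adj_0)
    then show ?thesis by (simp add: M_def adj_mult \<Theta> P_adj matrix_mul_assoc)
  qed
  \<comment> \<open>The identity lies in the commutant, so on the tensor power it is a combination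
    of the \<open>T h\<close>, each already annihilated between \<open>P\<close> and
    \<Theta>.\<close>
  have P\<Theta>: "P ** \<Theta> = 0"
  proof -
    have "mat 1 = (\<Sum>b\<in>B. (b \<bullet> mat 1) *\<^sub>R b)"
      using B commutant_mat1[of \<A>] unfolding casimir_basis_def by blast
    then have "(mat 1 :: ('n \<Rightarrow> 'd) operator) = tensor (\<lambda>_. \<Sum>b\<in>B. (b \<bullet> mat 1) *\<^sub>R b)"
      by (metis tensor_mat1)
    also have "\<dots> = (\<Sum>h\<in>I. (\<Prod>k\<in>UNIV. h k \<bullet> mat 1) *\<^sub>R T h)"
      by (simp add: tensor_sum[OF finB] tensor_scaleR I_def T_def)
    finally have "P ** mat 1 ** \<Theta> = (\<Sum>h\<in>I. (\<Prod>k\<in>UNIV. h k \<bullet> mat 1) *\<^sub>R (P ** T h ** \<Theta>))"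
      by (simp only: sum_mult_right sum_mult_left scaleR_mult_left scaleR_mult_right)
    also have "\<dots> = 0" by (simp add: PT\<Theta>)
    finally show ?thesis by simp
  qed
  \<comment> \<open>At \<open>mat 1\<close> the first term is \<open>R ** Q = mat 1 - P\<close>. The
    normalised trace is a positive functional with value 1 there, so the second term supplies the
    missing \<open>P\<close>; it is invisible to any \<open>X\<close> on the symmetric subspace,
    because \<open>P ** X = 0\<close>.\<close>
  define L where "L W = R ** F (\<Theta> ** W ** \<Theta>) + (trace W / of_nat CARD('n \<Rightarrow> 'd)) *\<^sub>M P" for W
  have linF: "clinear F" unfolding F_def by (rule clinear_tensor_kraus_map)
  show ?thesis
  proof
    show "clinear L"
      by (rule clinearI)
        (simp_all add: L_def matrix_add_ldistrib matrix_add_rdistrib clinear_add[OF linF]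
          clinear_scale[OF linF] scale_mat_mult_left scale_mat_mult_right trace_add trace_scale
          add_divide_distrib mat_space.scale_left_distrib mat_space.scale_right_distrib)
    show "L W \<in> algebra_tensor_power \<A>" for W
      using \<M>_mult[OF R(1) FM] PM
      by (simp add: L_def \<M>_def algebra_tensor_power_add algebra_tensor_power_scale)
    have "trace (mat 1 :: ('n \<Rightarrow> 'd) operator) = of_nat CARD('n \<Rightarrow> 'd)" by (rule trace_I)
    then show "L (mat 1) = mat 1"
      by (simp add: L_def \<Theta> P_def Q_def[symmetric])
    show "positive_op (L W)" if W: "positive_op W" for W
    proof -
      define b where "b = F (\<Theta> ** W ** \<Theta>)"
      have bM: "b \<in> \<M>" by (simp add: b_def FM)
      \<comment> \<open>A product of positive operators is positive only if they commute. Here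
        \<open>b\<close> is in the algebra, so it can be moved into \<open>F\<close>, and it is
        permutation invariant, so it commutes with \<Theta>; hence it commutes with \<open>Q\<close>
        and with \<open>R\<close>.\<close>
      have "b ** Q = F (b ** \<Theta>)" using F_left[OF bM] by (simp add: Q_def)
      also have "\<dots> = F (\<Theta> ** b)" using \<Theta>_F by (simp add: b_def)
      also have "\<dots> = Q ** b" using F_right[OF bM] by (simp add: Q_def)
      finally have "R ** b = b ** R" using R(3) by simp
      then have "positive_op (R ** b)"
        using R(2) F_pos[OF \<Theta>pos[OF W]] by (intro positive_op_mult_commute) (simp_all add: b_def)
      moreover have "trace W \<in> \<real>\<^sub>\<ge>\<^sub>0"
        using trace_mult_positive[OF W, of "mat 1"] by (simp add: positive_op_iff)
      then have "trace W = of_real (Re (trace W))" and "0 \<le> Re (trace W)"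
        by (auto simp: complex_nonneg_Reals_iff complex_eq_iff)
      then have "positive_op ((trace W / of_nat CARD('n \<Rightarrow> 'd)) *\<^sub>M P)"
        using positive_op_scaleR[OF P_pos, of "Re (trace W) / of_nat CARD('n \<Rightarrow> 'd)"]
        by (simp add: scaleR_eq_scale_mat)
      ultimately show ?thesis by (simp add: L_def b_def positive_op_add)
    qed
    show "trace (L W ** X) = trace (W ** X)"
      if sym: "sym_proj ** X = X" "X ** sym_proj = X"
        and com: "\<And>V. V \<in> gauge_group \<A> \<Longrightarrow> tensor_power V ** X = X ** tensor_power V" for W X
    proof -
      have sym': "\<Theta> ** X = X" "X ** \<Theta> = X" using sym by (simp_all add: \<Theta>_def)
      have key: "\<Theta> ** adj (T h) ** X = X ** adj (T h) ** \<Theta>" if "h \<in> I" for h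
        unfolding T_def adj_tensor \<Theta>_def
        by (rule sym_proj_tensor_commute[OF \<A> sym com]) (use hB[OF that] commutant_adj[OF \<A>] in auto)
      \<comment> \<open>\<open>key\<close> carries \<open>X\<close> to the left of the commutant
        factor, and cyclicity brings \<open>R ** T h\<close> next to it. As \<open>R\<close> is in
        the algebra it commutes with \<open>T h\<close>, which completes a summand of
        \<open>Q\<close>.\<close>
      have "trace (R ** (T h ** (\<Theta> ** W ** \<Theta>) ** adj (T h)) ** X)
          = trace (W ** X ** (adj (T h) ** \<Theta> ** T h) ** R ** \<Theta>)" if h: "h \<in> I" for h
      proof -
        have "trace (R ** (T h ** (\<Theta> ** W ** \<Theta>) ** adj (T h)) ** X)
            = trace ((R ** T h ** \<Theta>) ** (W ** (\<Theta> ** adj (T h) ** X)))"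
          by (simp only: matrix_mul_assoc)
        also have "\<dots> = trace ((W ** (\<Theta> ** adj (T h) ** X)) ** (R ** T h ** \<Theta>))"
          by (rule trace_mul_sym)
        also have "\<dots> = trace (W ** X ** (adj (T h) ** \<Theta> ** T h) ** R ** \<Theta>)"
          by (simp only: key[OF h] TM[OF h R(1), symmetric] matrix_mul_assoc)
        finally show ?thesis .
      qed
      then have "trace (R ** F (\<Theta> ** W ** \<Theta>) ** X) = trace (W ** X ** Q ** R ** \<Theta>)"
        by (simp add: F[of "\<Theta> ** W ** \<Theta>"] Q_adj sum_mult_left sum_mult_right trace_sum)
      also have "W ** X ** Q ** R ** \<Theta> = W ** X ** ((mat 1 - P) ** \<Theta>)"
        using R(3)[of Q] by (simp add: P_def matrix_mul_assoc) (simp flip: matrix_mul_assoc)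
      also have "(mat 1 - P) ** \<Theta> = \<Theta>" by (simp add: diff_mult_left P\<Theta>)
      also have "W ** X ** \<Theta> = W ** X" by (simp add: sym' flip: matrix_mul_assoc)
      finally have 1: "trace (R ** F (\<Theta> ** W ** \<Theta>) ** X) = trace (W ** X)" .
      have "P ** X = (P ** \<Theta>) ** X" by (simp add: sym' flip: matrix_mul_assoc)
      then have "P ** X = 0" by (simp add: P\<Theta>)
      then show ?thesis
        by (simp add: L_def matrix_add_rdistrib trace_add 1 scale_mat_mult_left trace_scale)
    qed
  qed
qed

section \<open>Channels\<close>

lemma quantum_channel_positive:
  assumes "quantum_channel \<Phi>" "positive_op X"
  shows "positive_op (\<Phi> X)"
proof -
  have "positive_block 1 (\<lambda>_ _. X) \<longrightarrow> positive_block 1 (\<lambda>_ _. \<Phi> X)"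
    using assms(1) unfolding quantum_channel_def completely_positive_def by blast
  moreover have "positive_block 1 (\<lambda>_ _. Y) \<longleftrightarrow> positive_op Y" for Y :: "'a operator"
    by (auto simp: positive_block_def positive_op_def)
  ultimately show ?thesis using assms(2) by simp
qed

lemma quantum_channel_density_ops:
  "quantum_channel \<Phi> \<Longrightarrow> \<rho> \<in> density_ops \<Longrightarrow> \<Phi> \<rho> \<in> density_ops"
  using quantum_channel_positive by (auto simp: density_ops_def quantum_channel_def)

lemma sum_prod_UNIV: "(\<Sum>x\<in>UNIV. g x) = (\<Sum>i\<in>UNIV. \<Sum>a\<in>UNIV. g (i, a))"
  for g :: "'a::finite \<times> 'b::finite \<Rightarrow> 'c::comm_monoid_add"
  by (simp add: sum.cartesian_product)

text \<open>The Kraus operators are read off from a decomposition of the Choi matrix.\<close>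
lemma quantum_channel_kraus:
  fixes \<Phi> :: "'d::finite operator \<Rightarrow> 'd operator"
  assumes "quantum_channel \<Phi>"
  obtains K :: "'d \<times> 'd \<Rightarrow> 'd operator" where "\<Phi> = kraus_map UNIV K"
proof -
  have lin: "clinear \<Phi>" and cp: "completely_positive \<Phi>"
    using assms by (simp_all add: quantum_channel_def)
  define k where "k = CARD('d)"
  obtain e where e: "bij_betw e {..<k} (UNIV :: 'd set)"
    using ex_bij_betw_nat_finite[of "UNIV :: 'd set"] by (auto simp: k_def lessThan_atLeast0)
  \<comment> \<open>The unnormalised maximally entangled state; its form is the squared modulus of
    \<open>z\<close>. The bijection \<open>e\<close> translates basis labels to the numeric ancilla
    indices, and the images of the blocks form the Choi matrix \<open>C\<close>.\<close>
  have "positive_block k (\<lambda>i j. matrix_unit (e i) (e j))"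
    unfolding positive_block_def
  proof
    fix v :: "nat \<Rightarrow> complex^'d"
    define z where "z = (\<Sum>j<k. v j $ e j)"
    have "cinner (v i) (matrix_unit (e i) (e j) *v v j) = cnj (v i $ e i) * v j $ e j" for i j
    proof -
      have "(matrix_unit (e i) (e j) *v v j) $ a = (if a = e i then v j $ e j else 0)" for a
        by (simp add: matrix_vector_mult_def mult_delta_left)
      then show ?thesis by (simp add: cinner_def mult_delta_right)
    qed
    then have "(\<Sum>i<k. \<Sum>j<k. cinner (v i) (matrix_unit (e i) (e j) *v v j)) = cnj z * z"
      by (simp add: z_def sum_product)
    then show "(\<Sum>i<k. \<Sum>j<k. cinner (v i) (matrix_unit (e i) (e j) *v v j)) \<in> \<real>\<^sub>\<ge>\<^sub>0"
      by (simp add: complex_nonneg_Reals_iff)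
  qed
  then have block: "positive_block k (\<lambda>i j. \<Phi> (matrix_unit (e i) (e j)))"
    using cp by (simp add: completely_positive_def)
  define C :: "('d \<times> 'd) operator"
    where "C = (\<chi> x y. \<Phi> (matrix_unit (fst x) (fst y)) $ snd x $ snd y)"
  have "positive_op C"
    unfolding positive_op_def
  proof
    fix w :: "complex^('d \<times> 'd)"
    define v where "v i = (\<chi> a. w $ (i, a))" for i
    have "cinner w (C *v w) = (\<Sum>i\<in>UNIV. \<Sum>a\<in>UNIV. \<Sum>j\<in>UNIV. \<Sum>b\<in>UNIV.
        cnj (w $ (i, a)) * (\<Phi> (matrix_unit i j) $ a $ b * w $ (j, b)))"
      by (simp add: cinner_def matrix_vector_mult_def C_def sum_prod_UNIV sum_distrib_left)
    also have "\<dots> = (\<Sum>i\<in>UNIV. \<Sum>j\<in>UNIV. \<Sum>a\<in>UNIV. \<Sum>b\<in>UNIV.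
        cnj (w $ (i, a)) * (\<Phi> (matrix_unit i j) $ a $ b * w $ (j, b)))"
      by (rule sum.cong[OF refl], rule sum.swap)
    also have "\<dots> = (\<Sum>i\<in>UNIV. \<Sum>j\<in>UNIV. cinner (v i) (\<Phi> (matrix_unit i j) *v v j))"
      by (simp add: cinner_def matrix_vector_mult_def v_def sum_distrib_left)
    also have "\<dots> = (\<Sum>i<k. \<Sum>j<k. cinner (v (e i)) (\<Phi> (matrix_unit (e i) (e j)) *v v (e j)))"
      by (simp add: sum.reindex_bij_betw[OF e, symmetric])
    also have "\<dots> \<in> \<real>\<^sub>\<ge>\<^sub>0"
      using block unfolding positive_block_def by (rule spec[where x="\<lambda>i. v (e i)"])
    finally show "cinner w (C *v w) \<in> \<real>\<^sub>\<ge>\<^sub>0" .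
  qed
  then obtain u :: "'d \<times> 'd \<Rightarrow> complex^('d \<times> 'd)" where u: "C = (\<Sum>m\<in>UNIV. outer (u m))"
    by (rule positive_op_decomposition)
  define K where "K m = (\<chi> a i. u m $ (i, a))" for m
  have "\<Phi> (matrix_unit i j) = kraus_map UNIV K (matrix_unit i j)" for i j
  proof -
    have "\<Phi> (matrix_unit i j) $ a $ b = C $ (i, a) $ (j, b)" for a b by (simp add: C_def)
    moreover have "(K m ** matrix_unit i j ** adj (K m)) $ a $ b = K m $ a $ i * cnj (K m $ b $ j)" for m a b
    proof -
      have "(K m ** matrix_unit i j) $ a $ c = (if c = j then K m $ a $ i else 0)" for c
        by (simp add: matrix_matrix_mult_def mult_delta_right)
      then show ?thesis
        by (simp add: matrix_matrix_mult_def[of "K m ** matrix_unit i j"] mult_delta_left)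
    qed
    ultimately show ?thesis by (simp add: vec_eq_iff u kraus_map_def K_def)
  qed
  then have "\<Phi> X = kraus_map UNIV K X" for X
    by (subst (1 2) clinear_expand) (simp_all add: lin clinear_kraus_map)
  then show ?thesis using that by blast
qed

text \<open>The Heisenberg picture of \<open>G\<close>: the adjoint for the bilinear trace pairing,
  read off by testing against matrix units.\<close>

definition adj_map :: "('m::finite operator \<Rightarrow> 'm operator) \<Rightarrow> 'm operator \<Rightarrow> 'm operator" where
  "adj_map G M = (\<chi> i j. trace (M ** G (matrix_unit j i)))"

lemma clinear_adj_map: "clinear (adj_map G)"
  by (rule clinearI)
    (simp_all add: vec_eq_iff adj_map_def matrix_add_rdistrib trace_add scale_mat_mult_left trace_scale)

lemma trace_adj_map:
  assumes "clinear G"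
  shows "trace (adj_map G M ** X) = trace (M ** G X)"
proof -
  have "trace (M ** G X) = (\<Sum>i\<in>UNIV. \<Sum>j\<in>UNIV. X $ i $ j * trace (M ** G (matrix_unit i j)))"
    by (subst clinear_expand[OF assms])
      (simp add: sum_mult_right trace_sum scale_mat_mult_right trace_scale)
  also have "\<dots> = (\<Sum>j\<in>UNIV. \<Sum>i\<in>UNIV. X $ i $ j * trace (M ** G (matrix_unit i j)))"
    by (rule sum.swap)
  also have "\<dots> = trace (adj_map G M ** X)"
    unfolding trace_def[of "adj_map G M ** X"] unfolding matrix_matrix_mult_def[of "adj_map G M"]
    by (simp add: adj_map_def mult.commute)
  finally show ?thesis by simp
qed

lemma positive_adj_map:
  assumes "clinear G" "\<And>X. positive_op X \<Longrightarrow> positive_op (G X)" "positive_op M"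
  shows "positive_op (adj_map G M)"
  unfolding positive_op_def
proof
  fix v
  have "cinner v (adj_map G M *v v) = trace (M ** G (outer v))"
    by (simp add: trace_adj_map[OF assms(1)] flip: trace_mult_outer)
  then show "cinner v (adj_map G M *v v) \<in> \<real>\<^sub>\<ge>\<^sub>0"
    using assms positive_op_outer trace_mult_positive by metis
qed

lemma adj_map_mat1:
  assumes "\<And>X. trace (G X) = trace X"
  shows "adj_map G (mat 1) = mat 1"
proof -
  have "trace (matrix_unit j i) = (if i = j then 1 else 0)" for i j :: 'a
    by (cases "i = j") (auto simp: trace_def intro: sum.neutral)
  moreover have "trace (mat 1 ** G X) = trace X" for X by (simp add: assms)
  ultimately show ?thesis
    by (simp only: vec_eq_iff adj_map_def vec_lambda_beta) (simp add: mat_def)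
qed

subsection \<open>States\<close>

lemma tensor_outer: "tensor (\<lambda>k. outer (v k)) = outer (\<chi> f. \<Prod>k\<in>UNIV. v k $ f k)"
  by (simp add: vec_eq_iff prod.distrib)

lemma tensor_power_density_ops:
  assumes "\<rho> \<in> density_ops"
  shows "(tensor_power \<rho> :: ('n::finite \<Rightarrow> 'd::finite) operator) \<in> density_ops"
proof -
  have "positive_op \<rho>" using assms by (simp add: density_ops_def)
  then obtain v :: "'d \<Rightarrow> complex^'d" where "\<rho> = (\<Sum>i\<in>UNIV. outer (v i))"
    by (rule positive_op_decomposition)
  then have "(tensor_power \<rho> :: ('n \<Rightarrow> 'd) operator)
      = (\<Sum>h\<in>UNIV \<rightarrow>\<^sub>E UNIV. outer (\<chi> f. \<Prod>k\<in>UNIV. v (h k) $ f k))"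
    by (simp add: tensor_power_def tensor_sum tensor_outer)
  then have "positive_op (tensor_power \<rho> :: ('n \<Rightarrow> 'd) operator)"
    by (simp add: positive_op_sum positive_op_outer)
  moreover have "trace (tensor_power \<rho> :: ('n \<Rightarrow> 'd) operator) = 1"
    using assms by (simp add: tensor_power_def trace_tensor density_ops_def)
  ultimately show ?thesis by (simp add: density_ops_def)
qed

text \<open>In a rank-one decomposition the squared norms add up to the trace. Boundedness of states
  is what makes the averages below integrable.\<close>

lemma density_ops_entry_bound:
  fixes \<rho> :: "'m::finite operator"
  assumes "\<rho> \<in> density_ops"
  shows "cmod (\<rho> $ i $ j) \<le> 1"
proof -
  have "positive_op \<rho>" using assms by (simp add: density_ops_def)
  then obtain v :: "'m \<Rightarrow> complex^'m" where v: "\<rho> = (\<Sum>i\<in>UNIV. outer (v i))"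
    by (rule positive_op_decomposition)
  have "cmod (\<rho> $ i $ j) \<le> (\<Sum>m\<in>UNIV. cmod (v m $ i) * cmod (v m $ j))"
    unfolding v by (simp add: norm_sum order_trans[OF norm_sum] norm_mult)
  also have "\<dots> \<le> (\<Sum>m\<in>UNIV. (norm (v m))\<^sup>2)"
    unfolding power2_eq_square by (intro sum_mono mult_mono Finite_Cartesian_Product.norm_nth_le) auto
  also have "(\<Sum>m\<in>UNIV. (norm (v m))\<^sup>2) = 1"
  proof -
    have "complex_of_real (\<Sum>m\<in>UNIV. (norm (v m))\<^sup>2) = trace \<rho>"
      by (simp add: v trace_sum trace_outer)
    also have "\<dots> = complex_of_real 1" using assms by (simp add: density_ops_def)
    finally show ?thesis by (simp only: of_real_eq_iff)
  qed
  finally show ?thesis .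
qed

lemma density_ops_norm_bound:
  fixes \<rho> :: "'m::finite operator"
  assumes "\<rho> \<in> density_ops"
  shows "norm \<rho> \<le> real (CARD('m) * CARD('m))"
proof -
  have "norm \<rho> \<le> (\<Sum>i\<in>UNIV. norm (\<rho> $ i))"
    unfolding norm_vec_def by (rule L2_set_le_sum) auto
  also have "\<dots> \<le> (\<Sum>i\<in>(UNIV::'m set). \<Sum>j\<in>(UNIV::'m set). 1)"
  proof (rule sum_mono)
    fix i
    have "norm (\<rho> $ i) \<le> (\<Sum>j\<in>UNIV. norm (\<rho> $ i $ j))"
      unfolding norm_vec_def[of "\<rho> $ i"] by (rule L2_set_le_sum) auto
    also have "\<dots> \<le> (\<Sum>j\<in>(UNIV::'m set). 1)"
      by (intro sum_mono density_ops_entry_bound assms)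
    finally show "norm (\<rho> $ i) \<le> (\<Sum>j\<in>(UNIV::'m set). 1)" .
  qed
  finally show ?thesis by simp
qed

subsection \<open>Covariance\<close>

lemma clinear_tensor_eqI:
  fixes F G :: "('n::finite \<Rightarrow> 'd::finite) operator \<Rightarrow> 'k::finite operator"
  assumes "clinear F" "clinear G" "\<And>A. F (tensor A) = G (tensor A)"
  shows "F X = G X"
  by (subst (1 2) clinear_expand) (simp_all add: assms flip: tensor_matrix_unit)

lemma clinear_conj_by: "clinear (conj_by V)"
  by (rule clinearI)
    (simp_all add: conj_by_def matrix_add_ldistrib matrix_add_rdistrib scale_mat_mult_left scale_mat_mult_right)

lemma clinear_compose: "clinear F \<Longrightarrow> clinear G \<Longrightarrow> clinear (\<lambda>X. F (G X))"
  by (rule clinearI) (simp_all add: clinear_add clinear_scale)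

text \<open>Conjugation by \<open>V\<close> may mix the Kraus operators, so covariance is compared
  on product tensors, where only the one-factor map occurs.\<close>

lemma tensor_kraus_map_covariant:
  fixes V :: "'d::finite operator" and X :: "('n::finite \<Rightarrow> 'd) operator"
  assumes "finite I" "\<And>X. kraus_map I K (conj_by V X) = conj_by V (kraus_map I K X)"
  shows "tensor_kraus_map I K (conj_by (tensor_power V) X)
    = conj_by (tensor_power V) (tensor_kraus_map I K X)"
proof (rule clinear_tensor_eqI[where X=X])
  show "clinear (\<lambda>X :: ('n \<Rightarrow> 'd) operator. tensor_kraus_map I K (conj_by (tensor_power V) X))"
      "clinear (\<lambda>X :: ('n \<Rightarrow> 'd) operator. conj_by (tensor_power V) (tensor_kraus_map I K X))"
    by (rule clinear_compose[OF clinear_tensor_kraus_map clinear_conj_by]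
        clinear_compose[OF clinear_conj_by clinear_tensor_kraus_map])+
  fix A :: "'n \<Rightarrow> 'd operator"
  have "conj_by (tensor_power V) (tensor A) = tensor (\<lambda>k. conj_by V (A k))" for A :: "'n \<Rightarrow> 'd operator"
    by (simp add: conj_by_def tensor_power_def adj_tensor tensor_mult)
  then show "tensor_kraus_map I K (conj_by (tensor_power V) (tensor A))
      = conj_by (tensor_power V) (tensor_kraus_map I K (tensor A))"
    using assms by (simp add: tensor_kraus_map_tensor)
qed

lemma norm_conj_by_unitary:
  assumes "unitary U" shows "norm (conj_by U X) = norm X"
proof -
  have "conj_by U X \<bullet> conj_by U X = X \<bullet> ((adj U ** U) ** X ** (adj U ** U))"
    unfolding conj_by_def[of U X]
    by (subst inner_op_mult_right) (subst inner_op_mult_left, simp add: matrix_mul_assoc)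
  then show ?thesis using assms by (simp add: unitary_def norm_eq_sqrt_inner)
qed

lemma unitary_conj_by_fixed_iff:
  assumes "unitary U"
  shows "conj_by U X = X \<longleftrightarrow> U ** X = X ** U"
proof
  assume "conj_by U X = X"
  then have "X ** U = U ** X ** (adj U ** U)" by (metis conj_by_def matrix_mul_assoc)
  then show "U ** X = X ** U" using assms by (simp add: unitary_def)
next
  assume "U ** X = X ** U"
  then have "conj_by U X = X ** (U ** adj U)" by (metis conj_by_def matrix_mul_assoc)
  then show "conj_by U X = X" using assms by (simp add: unitary_def)
qed

lemma unitary_tensor_power: "unitary V \<Longrightarrow> unitary (tensor_power V)"
  by (simp add: unitary_def tensor_power_def adj_tensor tensor_mult)

lemma conj_by_density_ops:
  assumes "unitary V" "\<rho> \<in> density_ops" shows "conj_by V \<rho> \<in> density_ops"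
proof -
  have "trace (conj_by V \<rho>) = trace (adj V ** V ** \<rho>)"
    unfolding conj_by_def by (metis trace_mul_sym matrix_mul_assoc)
  then show ?thesis
    using assms by (simp add: density_ops_def unitary_def) (simp add: conj_by_def positive_op_sandwich)
qed

text \<open>The element of minimal norm of a closed convex set is fixed by all isometries that preserve
  the set. This replaces averaging over the gauge group.\<close>
lemma invariant_representative:
  fixes Y Z :: "('n::finite \<Rightarrow> 'd::finite) operator" and K :: "'i::finite \<Rightarrow> 'd operator"
  assumes cov: "covariant (gauge_group \<A>) (kraus_map UNIV K)"
    and sym: "sym_proj ** Y = Y" "Y ** sym_proj = Y"
    and YZ: "tensor_kraus_map UNIV K Y = Z"
    and inv: "\<And>V. V \<in> gauge_group \<A> \<Longrightarrow> conj_by (tensor_power V) Z = Z"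
  obtains X where "sym_proj ** X = X" "X ** sym_proj = X" "tensor_kraus_map UNIV K X = Z"
    "\<And>a. a \<in> algebra_tensor_power \<A> \<Longrightarrow> trace (a ** X) = trace (a ** Y)"
    "\<And>V. V \<in> gauge_group \<A> \<Longrightarrow> tensor_power V ** X = X ** tensor_power V"
proof -
  define N where "N = (tensor_kraus_map UNIV K :: ('n \<Rightarrow> 'd) operator \<Rightarrow> _)"
  \<comment> \<open>Everything required of the representative. The conditions are affine and closed,
    and conjugation by a gauge \<open>tensor_power V\<close> preserves them: it commutes with the
    projector and the algebra, and the noise is covariant with invariant output
    \<open>Z\<close>.\<close>
  define S where "S = {X. sym_proj ** X = X \<and> X ** sym_proj = X \<and> N X = Z \<and>
    (\<forall>a\<in>algebra_tensor_power \<A>. trace (a ** X) = trace (a ** Y))}"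
  have linN: "linear N" unfolding N_def by (intro clinear_imp_linear clinear_tensor_kraus_map)
  have "Y \<in> S" using sym YZ by (simp add: S_def N_def)
  have "convex S"
    unfolding convex_def S_def
    by (auto simp: matrix_add_ldistrib matrix_add_rdistrib scaleR_mult_left scaleR_mult_right
        linear_add[OF linN] linear_scale[OF linN] trace_add trace_scaleR simp flip: scaleR_add_left)
  have "closed S"
  proof -
    have lin: "linear (\<lambda>X :: ('n \<Rightarrow> 'd) operator. a ** X)"
      "linear (\<lambda>X :: ('n \<Rightarrow> 'd) operator. X ** a)"
      "linear (\<lambda>X :: ('n \<Rightarrow> 'd) operator. trace (a ** X))"
      for a :: "('n \<Rightarrow> 'd) operator"
      by (auto intro!: linearI simp: matrix_add_ldistrib matrix_add_rdistrib scaleR_mult_left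
          scaleR_mult_right trace_add trace_scaleR)
    have "S = {X. sym_proj ** X = X} \<inter> {X. X ** sym_proj = X} \<inter> {X. N X = Z} \<inter>
        (\<Inter>a\<in>algebra_tensor_power \<A>. {X. trace (a ** X) = trace (a ** Y)})"
      by (auto simp: S_def)
    moreover have "closed \<dots>"
      by (intro closed_Int closed_INT ballI closed_Collect_eq continuous_on_id continuous_on_const
          linear_continuous_on lin[unfolded linear_conv_bounded_linear]
          linN[unfolded linear_conv_bounded_linear])
    ultimately show ?thesis by simp
  qed
  define X where "X = closest_point S 0"
  have XS: "X \<in> S" unfolding X_def using \<open>closed S\<close> \<open>Y \<in> S\<close> by (intro closest_point_in_set) auto
  have "tensor_power V ** X = X ** tensor_power V" if V: "V \<in> gauge_group \<A>" for V
  proof -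
    define U where "U = (tensor_power V :: ('n \<Rightarrow> 'd) operator)"
    have U: "unitary U" using V by (simp add: U_def gauge_group_def unitary_tensor_power)
    have symU: "sym_proj ** U = U ** sym_proj" unfolding U_def by (rule sym_proj_tensor_power)
    then have symU': "sym_proj ** adj U = adj U ** sym_proj"
      by (metis adj_mult adj_sym_proj)
    have "sym_proj ** conj_by U X = U ** (sym_proj ** X) ** adj U"
      by (simp only: conj_by_def matrix_mul_assoc symU)
    moreover have "conj_by U X ** sym_proj = U ** (X ** sym_proj) ** adj U"
      by (simp only: conj_by_def symU'[symmetric] flip: matrix_mul_assoc)
    ultimately have 1: "sym_proj ** conj_by U X = conj_by U X" "conj_by U X ** sym_proj = conj_by U X"
      using XS by (simp_all only: S_def mem_Collect_eq conj_by_def)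
    have "N (conj_by U X) = conj_by U (N X)"
      unfolding N_def U_def by (rule tensor_kraus_map_covariant) (use cov V in \<open>auto simp: covariant_def\<close>)
    then have 2: "N (conj_by U X) = Z" using XS inv[OF V] by (simp add: S_def U_def)
    have 3: "trace (a ** conj_by U X) = trace (a ** Y)" if a: "a \<in> algebra_tensor_power \<A>" for a
    proof -
      have "U ** a = a ** U"
        unfolding U_def tensor_power_def
        by (rule tensor_commutant_commutes[OF a]) (use V in \<open>simp add: gauge_group_def commutant_def\<close>)
      then have "a ** conj_by U X = U ** (a ** X ** adj U)"
        by (simp only: conj_by_def matrix_mul_assoc)
      then have "trace (a ** conj_by U X) = trace ((a ** X ** adj U) ** U)"
        by (simp only: trace_mul_sym[of U])
      also have "(a ** X ** adj U) ** U = a ** X"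
        using U by (simp add: unitary_def flip: matrix_mul_assoc)
      finally show ?thesis using XS a by (simp add: S_def)
    qed
    have "conj_by U X \<in> S" using 1 2 3 by (simp add: S_def)
    moreover have "dist 0 (conj_by U X) \<le> dist 0 W" if "W \<in> S" for W
      using closest_point_le[OF \<open>closed S\<close> that, of 0] by (simp add: norm_conj_by_unitary[OF U] X_def)
    ultimately have "conj_by U X = closest_point S 0"
      by (intro closest_point_unique \<open>convex S\<close> \<open>closed S\<close> ballI) blast+
    then have "conj_by U X = X" by (simp only: X_def)
    then show ?thesis using unitary_conj_by_fixed_iff[OF U] by (simp add: U_def)
  qed
  then show ?thesis using that[of X] XS by (simp add: S_def N_def)
qed

section \<open>Averaged states\<close>

lemma reference_measure_space: "reference_measure \<mu> \<Longrightarrow> space \<mu> = density_ops"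
  using sets_eq_imp_space_eq[of \<mu> "restrict_space borel density_ops"]
  by (simp add: reference_measure_def space_restrict_space)

lemma reference_measure_measurable_self:
  assumes "reference_measure \<mu>" "clinear f" "\<And>\<rho>. \<rho> \<in> density_ops \<Longrightarrow> f \<rho> \<in> density_ops"
  shows "f \<in> measurable \<mu> \<mu>"
proof -
  have sets: "sets \<mu> = sets (restrict_space borel density_ops)"
    using assms(1) by (simp add: reference_measure_def)
  have "f \<in> borel_measurable borel"
    by (intro borel_measurable_continuous_onI linear_continuous_on clinear_imp_bounded_linear assms)
  then have "f \<in> measurable (restrict_space borel density_ops) (restrict_space borel density_ops)"
    using assms(3) by (intro measurable_restrict_space3) auto
  then show ?thesis by (simp add: measurable_cong_sets[OF sets sets])
qed

lemma continuous_on_tensor_power: "continuous_on S tensor_power"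
  unfolding tensor_power_def tensor_def by (intro continuous_intros)

lemma reference_measure_tensor_power_measurable:
  assumes "reference_measure \<mu>"
  shows "(tensor_power :: 'd::finite operator \<Rightarrow> ('n::finite \<Rightarrow> 'd) operator) \<in> borel_measurable \<mu>"
proof -
  have sets: "sets \<mu> = sets (restrict_space borel density_ops)"
    using assms by (simp add: reference_measure_def)
  have "(tensor_power :: 'd operator \<Rightarrow> ('n \<Rightarrow> 'd) operator) \<in> borel_measurable borel"
    by (intro borel_measurable_continuous_onI continuous_on_tensor_power)
  then show ?thesis
    by (simp add: measurable_cong_sets[OF sets refl] measurable_restrict_space1)
qed

lemma povm_compose:
  assumes "povm \<Omega> M" "clinear L" "\<And>X. positive_op X \<Longrightarrow> positive_op (L X)" "L (mat 1) = mat 1"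
  shows "povm \<Omega> (\<lambda>B. L (M B))"
  using assms(1,3,4) bounded_linear.sums[OF clinear_imp_bounded_linear[OF assms(2)]]
  by (auto simp: povm_def)

text \<open>The ensemble selected by an event enters all outcome probabilities only through its average
  \<open>n\<close>-copy state \<open>Z\<close>. The witness \<open>Y\<close> is the average of the pure \<open>n\<close>-copy states that the
  distortion turns into the members of the ensemble.\<close>
lemma averaged_state:
  fixes \<A> :: "'d::finite operator set"
    and s :: "'d operator \<Rightarrow> real^'l::finite"
    and \<E> :: "('n::finite \<Rightarrow> 'd) operator \<Rightarrow> ('n \<Rightarrow> 'd) operator"
    and K :: "'i::finite \<Rightarrow> 'd operator"
  assumes \<mu>: "reference_measure \<mu>" and p: "prior_density \<mu> p"
    and psym: "prior_symmetry (gauge_group \<A>) p"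
    and ssym: "parameter_symmetry (gauge_group \<A>) p s"
    and noiseless: "noiseless_on (algebra_tensor_power \<A>) \<E>" "clinear \<E>"
    and p': "prior_density \<mu> p'" "prior_supp p' \<subseteq> pure_states"
    and dist: "distortion_via \<mu> \<A> p p' (kraus_map UNIV K)"
    and nz: "param_prob \<mu> p s \<Delta> \<noteq> 0"
  obtains Y Z :: "('n \<Rightarrow> 'd) operator"
  where "\<And>M :: 'o set \<Rightarrow> _. \<And>B. (LINT \<rho>:param_event p s \<Delta>|\<mu>. p \<rho> * outcome_prob \<E> M B \<rho>)
      = Re (trace (M B ** \<E> Z))"
    "sym_proj ** Y = Y" "Y ** sym_proj = Y" "tensor_kraus_map UNIV K Y = Z"
    "\<And>V. V \<in> gauge_group \<A> \<Longrightarrow> conj_by (tensor_power V) Z = Z"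
    "\<And>a. a \<in> algebra_tensor_power \<A> \<Longrightarrow> trace (a ** Z) = trace (a ** Y)"
    "\<And>a. a \<in> algebra_tensor_power \<A> \<Longrightarrow> trace (a ** \<E> Z) = trace (a ** Z)"
proof -
  define D where "D = (density_ops :: 'd operator set)"
  define Ev where "Ev = param_event p s \<Delta>"
  define \<tau> where "\<tau> = (tensor_power :: 'd operator \<Rightarrow> ('n \<Rightarrow> 'd) operator)"
  define N where "N = kraus_map UNIV K"
  define Nn where "Nn = (tensor_kraus_map UNIV K :: ('n \<Rightarrow> 'd) operator \<Rightarrow> _)"
  define f where "f \<rho> = indicator Ev \<rho> * p \<rho>" for \<rho>
  have space: "space \<mu> = D" using reference_measure_space[OF \<mu>] by (simp add: D_def)
  have chan: "quantum_channel N" and noiselessN: "noiseless_on \<A> N"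
    and law: "prior_law \<mu> p = distr (prior_law \<mu> p') \<mu> N"
    using dist by (simp_all add: distortion_via_def N_def)
  have pm: "p \<in> borel_measurable \<mu>" and p'm: "p' \<in> borel_measurable \<mu>"
    using p p' by (simp_all add: prior_density_def)
  have p0: "0 \<le> p \<rho>" if "\<rho> \<in> D" for \<rho> using p that by (simp add: prior_density_def D_def)
  have \<tau>m: "\<tau> \<in> borel_measurable \<mu>"
    unfolding \<tau>_def by (rule reference_measure_tensor_power_measurable[OF \<mu>])
  have \<tau>D: "\<tau> \<rho> \<in> density_ops" if "\<rho> \<in> D" for \<rho>
    using that by (simp add: \<tau>_def D_def tensor_power_density_ops)
  define c where "c = real (CARD('n \<Rightarrow> 'd) * CARD('n \<Rightarrow> 'd))"
  have \<tau>_bound: "norm (\<tau> \<rho>) \<le> c" if "\<rho> \<in> D" for \<rho>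
    unfolding c_def by (rule density_ops_norm_bound[OF \<tau>D[OF that]])
  have c0: "0 \<le> c" by (simp add: c_def)
  \<comment> \<open>A non-integrable function has integral 0 by convention, so nonzero probability
    forces integrability. Measurability of the event follows in turn, as \<open>f\<close> is nonzero
    exactly on \<open>Ev\<close>.\<close>
  have fint: "integrable \<mu> f"
  proof (rule ccontr)
    assume "\<not> integrable \<mu> f"
    then have "integral\<^sup>L \<mu> f = 0" by (rule not_integrable_integral_eq)
    then show False using nz by (simp add: param_prob_def set_lebesgue_integral_def f_def[abs_def] Ev_def)
  qed
  have EvD: "Ev \<subseteq> D" by (auto simp: Ev_def D_def param_event_def prior_supp_def)
  have Evm: "Ev \<in> sets \<mu>"
  proof -
    have "Ev = {\<rho>\<in>space \<mu>. f \<rho> \<noteq> 0}"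
      using EvD by (auto simp: f_def space Ev_def param_event_def prior_supp_def indicator_def)
    then show ?thesis using borel_measurable_integrable[OF fint] by simp
  qed
  define g where "g \<rho> = f \<rho> *\<^sub>R \<tau> \<rho>" for \<rho>
  have gint: "integrable \<mu> g"
  proof (rule Bochner_Integration.integrable_bound)
    show "integrable \<mu> (\<lambda>\<rho>. c * f \<rho>)" using fint by simp
    show "g \<in> borel_measurable \<mu>"
      unfolding g_def using borel_measurable_integrable[OF fint] \<tau>m by measurable
    show "AE \<rho> in \<mu>. norm (g \<rho>) \<le> norm (c * f \<rho>)"
    proof (intro AE_I2)
      fix \<rho> assume "\<rho> \<in> space \<mu>"
      then have "\<bar>f \<rho>\<bar> * norm (\<tau> \<rho>) \<le> \<bar>f \<rho>\<bar> * c"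
        using \<tau>_bound by (intro mult_left_mono) (simp_all add: space)
      then show "norm (g \<rho>) \<le> norm (c * f \<rho>)"
        using c0 by (simp add: g_def abs_mult mult.commute)
    qed
  qed
  \<comment> \<open>Not normalised: its trace is the probability of the event, which
    \<open>cond_prob\<close> divides out.\<close>
  define Z where "Z = integral\<^sup>L \<mu> g"
  have Nm: "N \<in> measurable \<mu> \<mu>"
    using chan quantum_channel_density_ops
    by (intro reference_measure_measurable_self[OF \<mu>]) (auto simp: quantum_channel_def)
  define law' where "law' = prior_law \<mu> p'"
  interpret law': prob_space law' using p' by (simp add: law'_def prior_density_def)
  have setsl: "sets law' = sets \<mu>" and spacel: "space law' = D"
    by (simp_all add: law'_def prior_law_def space)
  have Nml: "N \<in> measurable law' \<mu>" using Nm by (simp add: measurable_cong_sets[OF setsl refl])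
  have \<tau>ml: "\<tau> \<in> borel_measurable law'" using \<tau>m by (simp add: measurable_cong_sets[OF setsl refl])
  have ND: "N \<psi> \<in> D" if "\<psi> \<in> D" for \<psi>
    using that quantum_channel_density_ops[OF chan] by (simp add: D_def)
  \<comment> \<open>The event is pulled back along the noise: the pure states kept are those whose
    noisy image belongs to \<open>Ev\<close>.\<close>
  define y where "y \<psi> = (indicator Ev (N \<psi>) :: real) *\<^sub>R \<tau> \<psi>" for \<psi>
  have indm: "(\<lambda>\<psi>. indicator Ev (N \<psi>) :: real) \<in> borel_measurable law'"
    using measurable_compose[OF Nml borel_measurable_indicator[OF Evm]] by simp
  have yint: "integrable law' y"
  proof (rule law'.integrable_const_bound[of _ c])
    show "AE \<psi> in law'. norm (y \<psi>) \<le> c"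
      using \<tau>_bound c0 by (intro AE_I2) (auto simp: y_def spacel indicator_def)
    show "y \<in> borel_measurable law'" unfolding y_def using indm \<tau>ml by measurable
  qed
  define Y where "Y = integral\<^sup>L law' y"
  have Nn_\<tau>: "Nn (\<tau> \<psi>) = \<tau> (N \<psi>)" for \<psi>
    by (simp add: Nn_def \<tau>_def N_def tensor_power_def tensor_kraus_map_tensor)
  have Z_law: "Z = (\<integral>\<psi>. (indicator Ev (N \<psi>) :: real) *\<^sub>R \<tau> (N \<psi>) \<partial>law')"
  proof -
    have m: "(\<lambda>\<rho>. (indicator Ev \<rho> :: real) *\<^sub>R \<tau> \<rho>) \<in> borel_measurable \<mu>"
      using Evm \<tau>m by measurable
    have "Z = (\<integral>\<rho>. p \<rho> *\<^sub>R ((indicator Ev \<rho> :: real) *\<^sub>R \<tau> \<rho>) \<partial>\<mu>)"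
      by (simp add: Z_def g_def[abs_def] f_def mult.commute)
    also have "\<dots> = (\<integral>\<rho>. (indicator Ev \<rho> :: real) *\<^sub>R \<tau> \<rho> \<partial>density \<mu> (\<lambda>\<rho>. ennreal (p \<rho>)))"
      by (rule integral_density[symmetric]) (use m pm p0 in \<open>auto simp: space\<close>)
    also have "\<dots> = (\<integral>\<rho>. (indicator Ev \<rho> :: real) *\<^sub>R \<tau> \<rho> \<partial>distr law' \<mu> N)"
      using law by (simp add: prior_law_def law'_def)
    also have "\<dots> = (\<integral>\<psi>. (indicator Ev (N \<psi>) :: real) *\<^sub>R \<tau> (N \<psi>) \<partial>law')"
      by (rule integral_distr[OF Nml m])
    finally show ?thesis .
  qed
  have NnY: "Nn Y = Z"
  proof -
    have lin: "clinear Nn" unfolding Nn_def by (rule clinear_tensor_kraus_map)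
    have "Nn Y = (\<integral>\<psi>. Nn (y \<psi>) \<partial>law')"
      unfolding Y_def by (rule integral_bounded_linear[symmetric, OF clinear_imp_bounded_linear[OF lin] yint])
    then show ?thesis
      by (simp add: Z_law y_def linear_scale[OF clinear_imp_linear[OF lin]] Nn_\<tau>)
  qed
  have linl: "bounded_linear (\<lambda>X :: ('n \<Rightarrow> 'd) operator. a ** X)"
      "bounded_linear (\<lambda>X :: ('n \<Rightarrow> 'd) operator. X ** a)"
      "bounded_linear (\<lambda>X :: ('n \<Rightarrow> 'd) operator. trace (a ** X))" for a
    unfolding linear_conv_bounded_linear[symmetric]
    by (auto intro!: linearI simp: matrix_add_ldistrib matrix_add_rdistrib scaleR_mult_left
        scaleR_mult_right trace_add trace_scaleR)
  \<comment> \<open>Purity is known only where the density \<open>p'\<close> is nonzero, that is,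
    almost everywhere for its law.\<close>
  have pure: "AE \<psi> in law'. sym_proj ** y \<psi> = y \<psi> \<and> y \<psi> ** sym_proj = y \<psi>"
    unfolding law'_def prior_law_def
  proof (subst AE_density)
    show "(\<lambda>\<rho>. ennreal (p' \<rho>)) \<in> borel_measurable \<mu>" using p'm by simp
    show "AE \<psi> in \<mu>. 0 < ennreal (p' \<psi>) \<longrightarrow> sym_proj ** y \<psi> = y \<psi> \<and> y \<psi> ** sym_proj = y \<psi>"
    proof (intro AE_I2 impI)
      fix \<psi> assume "\<psi> \<in> space \<mu>" "0 < ennreal (p' \<psi>)"
      then have "\<psi> \<in> prior_supp p'" by (auto simp: prior_supp_def space D_def)
      then have "\<psi> \<in> pure_states" using p' by blast
      then obtain v where "\<psi> = outer v" by (auto simp: pure_states_def outer_def)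
      then have "sym_proj ** \<tau> \<psi> = \<tau> \<psi>" "\<tau> \<psi> ** sym_proj = \<tau> \<psi>"
        using sym_proj_pure[of v] by (simp_all add: \<tau>_def flip: sym_proj_tensor_power)
      then show "sym_proj ** y \<psi> = y \<psi> \<and> y \<psi> ** sym_proj = y \<psi>"
        by (simp add: y_def scaleR_mult_left scaleR_mult_right)
    qed
  qed
  have symY: "sym_proj ** Y = Y" "Y ** sym_proj = Y"
  proof -
    have "sym_proj ** Y = (\<integral>\<psi>. sym_proj ** y \<psi> \<partial>law')"
      unfolding Y_def by (rule integral_bounded_linear[symmetric, OF linl(1) yint])
    also have "\<dots> = Y"
      unfolding Y_def using pure yint borel_measurable_integrable[OF yint]
      by (intro integral_cong_AE) (auto intro!: borel_measurable_integrable integrable_bounded_linear[OF linl(1)])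
    finally show "sym_proj ** Y = Y" .
    have "Y ** sym_proj = (\<integral>\<psi>. y \<psi> ** sym_proj \<partial>law')"
      unfolding Y_def by (rule integral_bounded_linear[symmetric, OF linl(2) yint])
    also have "\<dots> = Y"
      unfolding Y_def using pure yint borel_measurable_integrable[OF yint]
      by (intro integral_cong_AE) (auto intro!: borel_measurable_integrable integrable_bounded_linear[OF linl(2)])
    finally show "Y ** sym_proj = Y" .
  qed
  \<comment> \<open>On product tensors the trace factorises over the copies, so one-copy
    noiselessness of \<open>N\<close> applies to each factor.\<close>
  have trace_\<tau>: "trace (a ** \<tau> (N \<psi>)) = trace (a ** \<tau> \<psi>)" if a: "a \<in> algebra_tensor_power \<A>" and "\<psi> \<in> D" for a \<psi>
    using a
  proof (induction rule: algebra_tensor_power_induct)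
    case zero
    then show ?case by simp
  next
    case (add x y)
    then show ?case by (simp add: matrix_add_rdistrib trace_add)
  next
    case (scale c x)
    then show ?case by (simp add: scale_mat_mult_left trace_scale)
  next
    case (tensor A)
    then show ?case
      using noiselessN \<open>\<psi> \<in> D\<close>
      by (simp add: \<tau>_def tensor_power_def tensor_mult trace_tensor noiseless_on_def D_def)
  qed
  have traceY: "trace (a ** Z) = trace (a ** Y)" if a: "a \<in> algebra_tensor_power \<A>" for a
  proof -
    have "trace (a ** Z) = trace (a ** Nn Y)" by (simp add: NnY)
    also have "\<dots> = (\<integral>\<psi>. trace (a ** Nn (y \<psi>)) \<partial>law')"
      unfolding Y_def Nn_def
      by (rule integral_bounded_linear[symmetric, OF
            bounded_linear_compose[OF linl(3) clinear_imp_bounded_linear[OF clinear_tensor_kraus_map]] yint])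
    also have "\<dots> = (\<integral>\<psi>. trace (a ** y \<psi>) \<partial>law')"
    proof (intro Bochner_Integration.integral_cong refl)
      fix \<psi> assume "\<psi> \<in> space law'"
      then have "trace (a ** \<tau> (N \<psi>)) = trace (a ** \<tau> \<psi>)" using a by (intro trace_\<tau>) (simp_all add: spacel)
      moreover have "Nn (y \<psi>) = (indicator Ev (N \<psi>) :: real) *\<^sub>R \<tau> (N \<psi>)"
        unfolding y_def by (simp add: linear_scale[OF clinear_imp_linear[OF clinear_tensor_kraus_map]]
            Nn_\<tau>[unfolded Nn_def] Nn_def)
      ultimately show "trace (a ** Nn (y \<psi>)) = trace (a ** y \<psi>)"
        by (simp add: y_def scaleR_mult_right trace_scaleR)
    qed
    also have "\<dots> = trace (a ** Y)"
      unfolding Y_def by (rule integral_bounded_linear[OF linl(3) yint])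
    finally show ?thesis .
  qed
  have traceE: "trace (a ** \<E> Z) = trace (a ** Z)" if a: "a \<in> algebra_tensor_power \<A>" for a
  proof -
    have "trace (a ** \<E> Z) = (\<integral>\<rho>. trace (a ** \<E> (g \<rho>)) \<partial>\<mu>)"
      unfolding Z_def
      by (rule integral_bounded_linear[symmetric, OF
            bounded_linear_compose[OF linl(3) clinear_imp_bounded_linear[OF noiseless(2)]] gint])
    also have "\<dots> = (\<integral>\<rho>. trace (a ** g \<rho>) \<partial>\<mu>)"
    proof (intro Bochner_Integration.integral_cong refl)
      fix \<rho> assume "\<rho> \<in> space \<mu>"
      then have "trace (a ** \<E> (\<tau> \<rho>)) = trace (a ** \<tau> \<rho>)"
        using noiseless(1) a \<tau>D by (simp add: noiseless_on_def space)
      then show "trace (a ** \<E> (g \<rho>)) = trace (a ** g \<rho>)"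
        by (simp add: g_def linear_scale[OF clinear_imp_linear[OF noiseless(2)]] scaleR_mult_right trace_scaleR)
    qed
    also have "\<dots> = trace (a ** Z)"
      unfolding Z_def by (rule integral_bounded_linear[OF linl(3) gint])
    finally show ?thesis .
  qed
  have inv: "conj_by (tensor_power V) Z = Z" if V: "V \<in> gauge_group \<A>" for V
  proof -
    have U: "unitary V" using V by (simp add: gauge_group_def)
    have Vm: "conj_by V \<in> measurable \<mu> \<mu>"
      by (rule reference_measure_measurable_self[OF \<mu> clinear_conj_by conj_by_density_ops[OF U]])
    have fV: "f (conj_by V \<rho>) = f \<rho>" if "\<rho> \<in> D" for \<rho>
    proof -
      have pV: "p (conj_by V \<rho>) = p \<rho>" using psym V that by (simp add: prior_symmetry_def D_def)
      have "conj_by V \<rho> \<in> D" using conj_by_density_ops[OF U] that by (simp add: D_def)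
      moreover have "s (conj_by V \<rho>) = s \<rho>" if "p \<rho> \<noteq> 0"
        using ssym V that \<open>\<rho> \<in> D\<close> by (simp add: parameter_symmetry_def prior_supp_def D_def)
      ultimately have "conj_by V \<rho> \<in> Ev \<longleftrightarrow> \<rho> \<in> Ev"
        using pV that by (auto simp: Ev_def param_event_def prior_supp_def D_def)
      then show ?thesis by (simp add: f_def pV indicator_def)
    qed
    \<comment> \<open>Invariance of the reference measure allows the substitution of
      \<open>conj_by V \<rho>\<close> for \<rho>; the weight \<open>f\<close> is unchanged by the
      symmetries of prior and parameters.\<close>
    have "distr \<mu> \<mu> (conj_by V) = \<mu>" using \<mu> U by (simp add: reference_measure_def)
    then have "Z = integral\<^sup>L (distr \<mu> \<mu> (conj_by V)) g" by (simp add: Z_def)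
    also have "\<dots> = (\<integral>\<rho>. g (conj_by V \<rho>) \<partial>\<mu>)"
      by (rule integral_distr[OF Vm borel_measurable_integrable[OF gint]])
    also have "\<dots> = (\<integral>\<rho>. conj_by (tensor_power V) (g \<rho>) \<partial>\<mu>)"
      by (intro Bochner_Integration.integral_cong refl)
        (simp add: g_def space fV \<tau>_def tensor_power_conj_by linear_scale[OF clinear_imp_linear[OF clinear_conj_by]])
    also have "\<dots> = conj_by (tensor_power V) Z"
      unfolding Z_def
      by (rule integral_bounded_linear[OF clinear_imp_bounded_linear[OF clinear_conj_by] gint])
    finally show ?thesis by simp
  qed
  have outcome: "(LINT \<rho>:param_event p s \<Delta>|\<mu>. p \<rho> * outcome_prob \<E> M B \<rho>) = Re (trace (M B ** \<E> Z))"
    for M :: "'o set \<Rightarrow> _" and B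
  proof -
    have "(LINT \<rho>:param_event p s \<Delta>|\<mu>. p \<rho> * outcome_prob \<E> M B \<rho>)
        = (\<integral>\<rho>. Re (trace (M B ** \<E> (g \<rho>))) \<partial>\<mu>)"
      unfolding set_lebesgue_integral_def
      by (intro Bochner_Integration.integral_cong refl)
        (simp add: g_def f_def Ev_def outcome_prob_def \<tau>_def
          linear_scale[OF clinear_imp_linear[OF noiseless(2)]] scaleR_mult_right trace_scaleR mult.assoc)
    also have "\<dots> = Re (trace (M B ** \<E> Z))"
      unfolding Z_def
      by (rule integral_bounded_linear[OF bounded_linear_compose[OF bounded_linear_Re
            bounded_linear_compose[OF linl(3) clinear_imp_bounded_linear[OF noiseless(2)]]] gint])
    finally show ?thesis .
  qed
  show ?thesis
    using that[OF outcome symY _ inv traceY traceE] NnY by (simp add: Nn_def)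
qed

theorem corollary15:
  fixes \<A> :: "'d::finite operator set"
    and \<mu> :: "'d operator measure"
    and p :: "'d operator \<Rightarrow> real"
    and s :: "'d operator \<Rightarrow> real^'l::finite"
    and \<E> :: "('n::finite \<Rightarrow> 'd) operator \<Rightarrow> ('n \<Rightarrow> 'd) operator"
    and \<Omega> :: "'o measure"
    and merit :: "('o set \<Rightarrow> ('n \<Rightarrow> 'd) operator) \<Rightarrow> real"
  assumes "reference_measure \<mu>"
    and "prior_density \<mu> p"
    and "s \<in> borel_measurable (restrict_space \<mu> (prior_supp p))"
    and "quantum_channel \<E>"
    and "functional_of_cond_probs \<Omega> \<mu> p s \<E> merit"
    and "von_neumann_algebra \<A>"
    and "prior_symmetry (gauge_group \<A>) p"
    and "parameter_symmetry (gauge_group \<A>) p s"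
    and "noiseless_on (algebra_tensor_power \<A>) \<E>"
    and "distortion_of_pure \<mu> \<A> p"
  shows "(\<forall>M. is_arg_max merit (povm \<Omega>) M \<longrightarrow>
             (\<exists>M'. is_arg_max merit (povm \<Omega>) M' \<and> (\<forall>B\<in>sets \<Omega>. M' B \<in> algebra_tensor_power \<A>)))
       \<and> (\<forall>M. is_arg_min merit (povm \<Omega>) M \<longrightarrow>
             (\<exists>M'. is_arg_min merit (povm \<Omega>) M' \<and> (\<forall>B\<in>sets \<Omega>. M' B \<in> algebra_tensor_power \<A>)))"
proof -
  obtain p' \<N> where p': "prior_density \<mu> p'" "prior_supp p' \<subseteq> pure_states"
    and dist: "distortion_via \<mu> \<A> p p' \<N>"
    using assms(10) by (auto simp: distortion_of_pure_def)
  then have chan: "quantum_channel \<N>" and cov: "covariant (gauge_group \<A>) \<N>"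
    by (simp_all add: distortion_via_def)
  \<comment> \<open>The Kraus form is what defines the action of the noise on all \<open>n\<close>
    copies.\<close>
  obtain K :: "'d \<times> 'd \<Rightarrow> 'd operator" where K: "\<N> = kraus_map UNIV K"
    using quantum_channel_kraus[OF chan] .
  have linE: "clinear \<E>" using assms(4) by (simp add: quantum_channel_def)
  obtain L :: "('n \<Rightarrow> 'd) operator \<Rightarrow> ('n \<Rightarrow> 'd) operator"
    where L: "clinear L" "\<And>W. positive_op W \<Longrightarrow> positive_op (L W)" "L (mat 1) = mat 1"
      "\<And>W. L W \<in> algebra_tensor_power \<A>"
      "\<And>W X. sym_proj ** X = X \<Longrightarrow> X ** sym_proj = X \<Longrightarrow>
        (\<And>V. V \<in> gauge_group \<A> \<Longrightarrow> tensor_power V ** X = X ** tensor_power V) \<Longrightarrow>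
        trace (L W ** X) = trace (W ** X)"
    using reduction_map[OF assms(6)] by blast
  \<comment> \<open>The whole way from \<open>X\<close> to the measured state: noise on every copy,
    then the channel. Its Heisenberg dual turns \<open>M\<close> into a POVM acting directly on
    \<open>X\<close>.\<close>
  define G where "G X = \<E> (tensor_kraus_map UNIV K X)" for X
  have linG: "clinear G" unfolding G_def by (rule clinear_compose[OF linE clinear_tensor_kraus_map])
  have G_pos: "positive_op (G X)" if "positive_op X" for X
    unfolding G_def tensor_kraus_map_def
    by (rule quantum_channel_positive[OF assms(4) positive_kraus_map[OF that]])
  have "trace (kraus_map UNIV K X) = trace X" for X
    using chan by (simp add: quantum_channel_def K)
  then have G_trace: "trace (G X) = trace X" for X
    using assms(4) by (simp add: G_def quantum_channel_def trace_tensor_kraus_map)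
  define \<Psi> where "\<Psi> M = L (adj_map G M)" for M
  have \<Psi>: "povm \<Omega> (\<lambda>B. \<Psi> (M B))" if "povm \<Omega> M" for M :: "'o set \<Rightarrow> ('n \<Rightarrow> 'd) operator"
    unfolding \<Psi>_def
    by (rule povm_compose[OF that clinear_compose[OF L(1) clinear_adj_map]])
      (simp_all add: L positive_adj_map[OF linG G_pos] adj_map_mat1[OF G_trace])
  have "cond_prob \<mu> p s \<E> M B \<Delta> = cond_prob \<mu> p s \<E> (\<lambda>B. \<Psi> (M B)) B \<Delta>"
    if nz: "param_prob \<mu> p s \<Delta> \<noteq> 0" for M :: "'o set \<Rightarrow> ('n \<Rightarrow> 'd) operator" and B \<Delta>
  proof -
    obtain Y Z :: "('n \<Rightarrow> 'd) operator"
      where Z: "\<And>M :: 'o set \<Rightarrow> _. \<And>B. (LINT \<rho>:param_event p s \<Delta>|\<mu>. p \<rho> * outcome_prob \<E> M B \<rho>)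
          = Re (trace (M B ** \<E> Z))"
        and Y: "sym_proj ** Y = Y" "Y ** sym_proj = Y" "tensor_kraus_map UNIV K Y = Z"
        and inv: "\<And>V. V \<in> gauge_group \<A> \<Longrightarrow> conj_by (tensor_power V) Z = Z"
        and tr: "\<And>a. a \<in> algebra_tensor_power \<A> \<Longrightarrow> trace (a ** Z) = trace (a ** Y)"
          "\<And>a. a \<in> algebra_tensor_power \<A> \<Longrightarrow> trace (a ** \<E> Z) = trace (a ** Z)"
      by (rule averaged_state[OF assms(1,2,7,8,9) linE p' dist[unfolded K] nz, where ?'o = 'o])
        (rule that)
    obtain X where X: "sym_proj ** X = X" "X ** sym_proj = X" "tensor_kraus_map UNIV K X = Z"
        "\<And>a. a \<in> algebra_tensor_power \<A> \<Longrightarrow> trace (a ** X) = trace (a ** Y)"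
        "\<And>V. V \<in> gauge_group \<A> \<Longrightarrow> tensor_power V ** X = X ** tensor_power V"
      using invariant_representative[OF cov[unfolded K] Y inv] by (metis (no_types))
    \<comment> \<open>The new element lies in the algebra, so channel and noise are invisible to it:
      \<E> is removed first, then \<open>Z\<close> is replaced by \<open>Y\<close> and
      \<open>Y\<close> by \<open>X\<close>.\<close>
    have "trace (\<Psi> (M B) ** \<E> Z) = trace (\<Psi> (M B) ** X)"
      by (simp add: \<Psi>_def L(4) X(4) tr)
    also have "\<dots> = trace (adj_map G (M B) ** X)"
      unfolding \<Psi>_def by (rule L(5)[OF X(1,2,5)])
    also have "\<dots> = trace (M B ** \<E> Z)"
      by (simp add: trace_adj_map[OF linG] G_def X(3))
    finally show ?thesis by (simp add: cond_prob_def Z)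
  qed
  then have merit: "merit M = merit (\<lambda>B. \<Psi> (M B))" if "povm \<Omega> M" for M
    using assms(5) that \<Psi>[OF that] unfolding functional_of_cond_probs_def by blast
  have \<Psi>_in: "\<Psi> W \<in> algebra_tensor_power \<A>" for W by (simp add: \<Psi>_def L(4))
  show ?thesis
  proof (intro conjI allI impI)
    fix M assume "is_arg_max merit (povm \<Omega>) M"
    then have "is_arg_max merit (povm \<Omega>) (\<lambda>B. \<Psi> (M B))"
      using \<Psi>[of M] merit[of M] by (simp add: is_arg_max_def)
    then show "\<exists>M'. is_arg_max merit (povm \<Omega>) M' \<and> (\<forall>B\<in>sets \<Omega>. M' B \<in> algebra_tensor_power \<A>)"
      using \<Psi>_in by blast
  next
    fix M assume "is_arg_min merit (povm \<Omega>) M"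
    then have "is_arg_min merit (povm \<Omega>) (\<lambda>B. \<Psi> (M B))"
      using \<Psi>[of M] merit[of M] by (simp add: is_arg_min_def)
    then show "\<exists>M'. is_arg_min merit (povm \<Omega>) M' \<and> (\<forall>B\<in>sets \<Omega>. M' B \<in> algebra_tensor_power \<A>)"
      using \<Psi>_in by blast
  qed
qed

end
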